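(* Let $H$ be a Hopf algebra over $k$. Suppose the subgroup $\langle W_{\times}\rangle$ of $G(H)$ is abelian. Then $$\operatorname{GKdim} H\geq \operatorname{GKdim} C_0+\dim Z/(C_0+Y_{\sqrt{\;}}).$$
   Context: $k$ is an algebraically closed field of characteristic zero and everything is over $k$. $G(H)$ is the group of group-like elements of $H$ and $C_0=kG(H)$ is its linear span. A nonzero element $y\in H$ is called skew primitive (always meaning $(1,g)$-primitive) if $\Delta(y)=y\otimes 1+g\otimes y$ for some $g$; then $g$ is group-like and uniquely determined, is called the weight of $y$, and is denoted $\mu(y)$. $W$ is the set of weights $\mu(y)$ of all skew primitive $y\notin C_0$. For a group-like $g$ let $T_{g^{-1}}:H\to H$, $a\mapsto g^{-1}ag$. For a skew primitive $y\notin C_0$ with $g=\mu(y)$, a scalar $c\in k^\times$ is called a commutator of $y$ of level $n$ if $n$ is the least nonnegative integer such that $(T_{g^{-1}}-c\,\mathrm{Id}_H)^n(y)\in C_0$; in this case $c$ is unique and one writes $\gamma(y)=c$ (the commutator of $y$, of finite level, may fail to exist). $W_{\times}$ is the subset of $W$ consisting of the weights $\mu(y)$ of skew primitive $y\notin C_0$ such that the commutator $\gamma(y)$ (of some finite level) exists and is either $1$ or not a root of unity. $\langle W_\times\rangle$ is the subgroup of $G(H)$ generated by $W_\times$. $Z$ is the subspace of $H$ spanned by $1$ and all skew primitive elements of $H$ (so $C_0\subset Z$), and $Y_{\sqrt{\;}}$ is the subspace of $Z$ spanned by those skew primitive $y\notin C_0$ having a commutator of finite level with $\gamma(y)$ a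 root of unity different from $1$. $\operatorname{GKdim}$ is Gelfand-Kirillov dimension, with values in $[0,\infty]$; infinite dimension is read as $\infty$. *)

theory Defs
  imports
    "HOL-Computational_Algebra.Polynomial"
    "HOL-Library.Poly_Mapping"
    "HOL-Library.Extended_Real"
    "HOL-Library.Liminf_Limsup"
    "HOL-Algebra.Generated_Groups"
    Complex_Main
begin

subsection \<open>Tensor powers as formal sums modulo multilinearity\<close>

text \<open>
  The type \<open>'a \<Rightarrow>\<^sub>0 'k\<close> of finitely supported functions is the free vector space on \<open>'a\<close>.
  For a vector space \<open>'h\<close>, the spaces H \<otimes> H and H \<otimes> H \<otimes> H are the quotients of the free vector
  spaces on \<open>'h \<times> 'h\<close> and \<open>'h \<times> 'h \<times> 'h\<close> by the subspaces spanned by the multilinearity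
  relations.  Since these quotients depend on the scalar multiplication, which is a term, they
  cannot be types; tensors are therefore given by representing formal sums, and equality of
  tensors is the congruence modulo the relations.
\<close>

definition fscale :: "'k::field \<Rightarrow> ('a \<Rightarrow>\<^sub>0 'k) \<Rightarrow> ('a \<Rightarrow>\<^sub>0 'k)" where
  "fscale c t = Poly_Mapping.map ((*) c) t"

definition pure :: "'a \<Rightarrow> ('a \<Rightarrow>\<^sub>0 'k::field)" where
  "pure p = Poly_Mapping.single p 1"

text \<open>The linear extension of a map from the basis \<open>'a\<close> to a space with scalar multiplication \<open>s\<close>.\<close>

definition lin_extend ::
  "('k::field \<Rightarrow> 'v \<Rightarrow> 'v::ab_group_add) \<Rightarrow> ('a \<Rightarrow> 'v) \<Rightarrow> ('a \<Rightarrow>\<^sub>0 'k) \<Rightarrow> 'v" where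
  "lin_extend s f t = (\<Sum>p\<in>Poly_Mapping.keys t. s (Poly_Mapping.lookup t p) (f p))"

lemma lookup_fscale: "Poly_Mapping.lookup (fscale c t) p = c * Poly_Mapping.lookup t p"
  unfolding fscale_def by (simp add: Poly_Mapping.map.rep_eq when_def)

lemma vector_space_fscale: "vector_space (fscale :: 'k::field \<Rightarrow> ('a \<Rightarrow>\<^sub>0 'k) \<Rightarrow> _)"
  by unfold_locales
    (auto intro!: poly_mapping_eqI simp: lookup_fscale lookup_add algebra_simps)

definition tensor2_null ::
  "('k::field \<Rightarrow> 'h \<Rightarrow> 'h::ab_group_add) \<Rightarrow> ('h \<times> 'h \<Rightarrow>\<^sub>0 'k) set" where
  "tensor2_null s = module.span fscale
     ({pure (a + a', b) - pure (a, b) - pure (a', b) | a a' b. True} \<union>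
      {pure (a, b + b') - pure (a, b) - pure (a, b') | a b b'. True} \<union>
      {pure (s c a, b) - fscale c (pure (a, b)) | c a b. True} \<union>
      {pure (a, s c b) - fscale c (pure (a, b)) | c a b. True})"

definition tensor3_null ::
  "('k::field \<Rightarrow> 'h \<Rightarrow> 'h::ab_group_add) \<Rightarrow> ('h \<times> 'h \<times> 'h \<Rightarrow>\<^sub>0 'k) set" where
  "tensor3_null s = module.span fscale
     ({pure (a + a', b, d) - pure (a, b, d) - pure (a', b, d) | a a' b d. True} \<union>
      {pure (a, b + b', d) - pure (a, b, d) - pure (a, b', d) | a b b' d. True} \<union>
      {pure (a, b, d + d') - pure (a, b, d) - pure (a, b, d') | a b d d'. True} \<union>
      {pure (s c a, b, d) - fscale c (pure (a, b, d)) | c a b d. True} \<union>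
      {pure (a, s c b, d) - fscale c (pure (a, b, d)) | c a b d. True} \<union>
      {pure (a, b, s c d) - fscale c (pure (a, b, d)) | c a b d. True})"

definition tensor2_eq ::
  "('k::field \<Rightarrow> 'h \<Rightarrow> 'h::ab_group_add) \<Rightarrow> ('h \<times> 'h \<Rightarrow>\<^sub>0 'k) \<Rightarrow> ('h \<times> 'h \<Rightarrow>\<^sub>0 'k) \<Rightarrow> bool" where
  "tensor2_eq s t u \<longleftrightarrow> t - u \<in> tensor2_null s"

definition tensor3_eq ::
  "('k::field \<Rightarrow> 'h \<Rightarrow> 'h::ab_group_add) \<Rightarrow>
   ('h \<times> 'h \<times> 'h \<Rightarrow>\<^sub>0 'k) \<Rightarrow> ('h \<times> 'h \<times> 'h \<Rightarrow>\<^sub>0 'k) \<Rightarrow> bool" where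
  "tensor3_eq s t u \<longleftrightarrow> t - u \<in> tensor3_null s"

text \<open>The product (a \<otimes> b)(c \<otimes> d) = ac \<otimes> bd of H \<otimes> H, and the maps \<open>\<Delta> \<otimes> id\<close> and \<open>id \<otimes> \<Delta>\<close>.\<close>

definition tensor2_mult ::
  "('h::ring_1 \<times> 'h \<Rightarrow>\<^sub>0 'k::field) \<Rightarrow> ('h \<times> 'h \<Rightarrow>\<^sub>0 'k) \<Rightarrow> ('h \<times> 'h \<Rightarrow>\<^sub>0 'k)" where
  "tensor2_mult t u =
     lin_extend fscale (\<lambda>(a, b). lin_extend fscale (\<lambda>(c, d). pure (a * c, b * d)) u) t"

definition comult_left ::
  "('h \<Rightarrow> ('h \<times> 'h \<Rightarrow>\<^sub>0 'k::field)) \<Rightarrow> ('h \<times> 'h \<Rightarrow>\<^sub>0 'k) \<Rightarrow> ('h \<times> 'h \<times> 'h \<Rightarrow>\<^sub>0 'k)" where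
  "comult_left comult =
     lin_extend fscale (\<lambda>(a, b). lin_extend fscale (\<lambda>(a1, a2). pure (a1, a2, b)) (comult a))"

definition comult_right ::
  "('h \<Rightarrow> ('h \<times> 'h \<Rightarrow>\<^sub>0 'k::field)) \<Rightarrow> ('h \<times> 'h \<Rightarrow>\<^sub>0 'k) \<Rightarrow> ('h \<times> 'h \<times> 'h \<Rightarrow>\<^sub>0 'k)" where
  "comult_right comult =
     lin_extend fscale (\<lambda>(a, b). lin_extend fscale (\<lambda>(b1, b2). pure (a, b1, b2)) (comult b))"


subsection \<open>Algebras, dimension of quotients, Gelfand-Kirillov dimension\<close>

locale assoc_algebra = vector_space scale
  for scale :: "'k::field \<Rightarrow> 'h::ring_1 \<Rightarrow> 'h" +
  assumes scale_mult_left: "scale c (x * y) = scale c x * y"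
    and scale_mult_right: "scale c (x * y) = x * scale c y"
begin

text \<open>The cosets of the elements of \<open>B\<close> form a basis of Z / U.\<close>

definition quotient_basis :: "'h set \<Rightarrow> 'h set \<Rightarrow> 'h set \<Rightarrow> bool" where
  "quotient_basis Z U B \<longleftrightarrow>
     B \<subseteq> Z \<and> Z \<subseteq> span (B \<union> U) \<and>
     (\<forall>F f. finite F \<and> F \<subseteq> B \<and> (\<Sum>b\<in>F. scale (f b) b) \<in> U \<longrightarrow> (\<forall>b\<in>F. f b = 0))"

text \<open>dim Z / U for subspaces U \<subseteq> Z, with value \<open>\<infinity>\<close> if it is not finite.\<close>

definition quotient_dim :: "'h set \<Rightarrow> 'h set \<Rightarrow> ereal" where
  "quotient_dim Z U =
     (if \<exists>B. finite B \<and> quotient_basis Z U B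
      then ereal (real (card (SOME B. finite B \<and> quotient_basis Z U B))) else \<infinity>)"

text \<open>The subspace k + V + V^2 + ... + V^n.\<close>

definition growth_space :: "'h set \<Rightarrow> nat \<Rightarrow> 'h set" where
  "growth_space V n = span {prod_list xs | xs. set xs \<subseteq> V \<and> length xs \<le> n}"

text \<open>
  The Gelfand-Kirillov dimension of a subalgebra \<open>A\<close>: the supremum of
  limsup log_n dim (k + V + ... + V^n) over the finite-dimensional subspaces V of A.
\<close>

definition GKdim :: "'h set \<Rightarrow> ereal" where
  "GKdim A =
     (SUP V \<in> {V. subspace V \<and> V \<subseteq> A \<and> (\<exists>B. finite B \<and> V = span B)}.
        limsup (\<lambda>n. ereal (log (real n) (real (dim (growth_space V n))))))"

end


subsection \<open>Hopf algebras\<close>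

text \<open>
  The value \<open>comult x\<close> is a formal sum representing the tensor \<open>\<Delta> x\<close>; all axioms concern only
  the induced map \<open>\<Delta>\<close> from H to H \<otimes> H.
\<close>

locale hopf_algebra = assoc_algebra scale
  for scale :: "'k::field \<Rightarrow> 'h::ring_1 \<Rightarrow> 'h" +
  fixes comult :: "'h \<Rightarrow> ('h \<times> 'h \<Rightarrow>\<^sub>0 'k)"
    and counit :: "'h \<Rightarrow> 'k"
    and antipode :: "'h \<Rightarrow> 'h"
  assumes comult_add: "tensor2_eq scale (comult (x + y)) (comult x + comult y)"
    and comult_scale: "tensor2_eq scale (comult (scale c x)) (fscale c (comult x))"
    and comult_one: "tensor2_eq scale (comult 1) (pure (1, 1))"
    and comult_mult: "tensor2_eq scale (comult (x * y)) (tensor2_mult (comult x) (comult y))"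
    and coassoc: "tensor3_eq scale (comult_left comult (comult x)) (comult_right comult (comult x))"
    and counit_linear: "Vector_Spaces.linear scale (*) counit"
    and counit_one: "counit 1 = 1"
    and counit_mult: "counit (x * y) = counit x * counit y"
    and counit_left: "lin_extend scale (\<lambda>(a, b). scale (counit a) b) (comult x) = x"
    and counit_right: "lin_extend scale (\<lambda>(a, b). scale (counit b) a) (comult x) = x"
    and antipode_linear: "Vector_Spaces.linear scale scale antipode"
    and antipode_left:
      "lin_extend scale (\<lambda>(a, b). antipode a * b) (comult x) = scale (counit x) 1"
    and antipode_right:
      "lin_extend scale (\<lambda>(a, b). a * antipode b) (comult x) = scale (counit x) 1"
begin

definition grouplike :: "'h \<Rightarrow> bool" where
  "grouplike g \<longleftrightarrow> g \<noteq> 0 \<and> tensor2_eq scale (comult g) (pure (g, g))"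

definition grouplike_group :: "'h monoid" where
  "grouplike_group = \<lparr>carrier = Collect grouplike, monoid.mult = (*), one = 1\<rparr>"

definition C0 :: "'h set" where
  "C0 = span (Collect grouplike)"

text \<open>
  \<open>skew_primitive g y\<close>: the element \<open>y\<close> is (1,g)-primitive, i.e. skew primitive of weight \<open>g\<close>.
  For y \<noteq> 0 the equation determines \<open>g\<close>, and \<open>g\<close> is automatically group-like except in the
  degenerate case that \<open>y\<close> is a scalar and g = 0.
\<close>

definition skew_primitive :: "'h \<Rightarrow> 'h \<Rightarrow> bool" where
  "skew_primitive g y \<longleftrightarrow>
     y \<noteq> 0 \<and> grouplike g \<and> tensor2_eq scale (comult y) (pure (y, 1) + pure (g, y))"

text \<open>The map \<open>T - c Id\<close>, where \<open>T a = g\<inverse> a g\<close>.\<close>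

definition conj_minus :: "'h \<Rightarrow> 'k \<Rightarrow> 'h \<Rightarrow> 'h" where
  "conj_minus g c a = inv\<^bsub>grouplike_group\<^esub> g * a * g - scale c a"

text \<open>The scalar \<open>c\<close> is a commutator of level \<open>n\<close> of the skew primitive \<open>y\<close> of weight \<open>g\<close>.\<close>

definition commutator_of_level :: "'h \<Rightarrow> 'h \<Rightarrow> 'k \<Rightarrow> nat \<Rightarrow> bool" where
  "commutator_of_level g y c n \<longleftrightarrow>
     c \<noteq> 0 \<and> (conj_minus g c ^^ n) y \<in> C0 \<and> (\<forall>m<n. (conj_minus g c ^^ m) y \<notin> C0)"

definition has_commutator :: "'h \<Rightarrow> 'h \<Rightarrow> 'k \<Rightarrow> bool" where
  "has_commutator g y c \<longleftrightarrow> (\<exists>n. commutator_of_level g y c n)"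

definition root_of_unity :: "'k \<Rightarrow> bool" where
  "root_of_unity c \<longleftrightarrow> (\<exists>n>0. c ^ n = 1)"

definition W_times :: "'h set" where
  "W_times = {g. \<exists>y c. skew_primitive g y \<and> y \<notin> C0 \<and> has_commutator g y c \<and>
                       (c = 1 \<or> \<not> root_of_unity c)}"

definition W_times_subgroup :: "'h monoid" where
  "W_times_subgroup = grouplike_group \<lparr>carrier := generate grouplike_group W_times\<rparr>"

definition Z :: "'h set" where
  "Z = span (insert 1 {y. \<exists>g. skew_primitive g y})"

definition Y_sqrt :: "'h set" where
  "Y_sqrt = span {y. \<exists>g c. skew_primitive g y \<and> y \<notin> C0 \<and> has_commutator g y c \<and>
                           root_of_unity c \<and> c \<noteq> 1}"

end

end

theory Submission
  imports Defs "HOL-Analysis.Extended_Real_Limits"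
begin

text \<open>
  Write \<open>P\<^sub>g\<close> for the space of all \<open>y\<close> with \<open>\<Delta> y = y \<otimes> 1 + g \<otimes> y\<close> and \<open>T\<^sub>g\<close> for the map
  \<open>x \<mapsto> g\<^sup>-\<^sup>1 x g\<close>, which preserves \<open>P\<^sub>g\<close>.  The lower bound is obtained by exhibiting many linearly
  independent products.  Suppose that \<open>y\<^sub>1, \<dots>, y\<^sub>d\<close> are skew primitive elements such that the products
  \<open>h y\<^sub>1\<^sup>n\<^sup>1 \<cdots> y\<^sub>d\<^sup>n\<^sup>d\<close> with \<open>h\<close> group-like are linearly independent.  A finite-dimensional subspace
  \<open>V\<close> of \<open>C\<^sub>0\<close> lies in the span of finitely many group-like elements; adjoining the \<open>y\<^sub>i\<close> to these
  gives a space whose products of length at most \<open>(d + 1) n\<close> span a dimension of at least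
  \<open>(n + 1)\<^sup>d\<close> times that of the products of length at most \<open>n\<close> of \<open>V\<close>.  Hence GKdim H is at
  least GKdim \<open>C\<^sub>0\<close> plus \<open>d\<close> (lemmas \<open>growth_exponent_add_le_GKdim\<close> and \<open>GKdim_C0_add_le\<close>), and it
  remains to find such \<open>y\<^sub>i\<close> for every \<open>d\<close> up to dim \<open>Z / (C\<^sub>0 + Y)\<close>, where \<open>Y\<close> is spanned by the
  skew primitive elements whose commutator is a root of unity different from 1.

  Independence is proved with operators that delete a letter.  For a linear functional \<open>f\<close> that
  vanishes on the group-like elements, \<open>x \<mapsto> x\<^sub>1 f(x\<^sub>2)\<close> lowers the number of skew primitive letters
  of a word by one: modulo shorter words it sends \<open>w\<^sub>1 \<cdots> w\<^sub>n\<close> to the sum over \<open>i\<close> of \<open>f(w\<^sub>i)\<close> times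
  the word in which \<open>w\<^sub>i\<close> is replaced by its weight.  Now let \<open>y = y\<^sub>1\<close> have weight \<open>g\<close>, and suppose
  that \<open>f\<close> is 1 at \<open>y\<close> and vanishes on a subspace \<open>X\<close> that contains \<open>C\<^sub>0\<close> and all later letters, such
  that \<open>T\<^sub>g\<close> preserves \<open>X \<inter> P\<^sub>g\<close> and \<open>T\<^sub>g y\<close> is \<open>q y\<close> modulo \<open>X\<close>.  Moving \<open>g\<close> to the front gives
  \<open>y\<^sup>m r \<mapsto> (1 + q + \<cdots> + q\<^sup>m\<^sup>-\<^sup>1) g y\<^sup>m\<^sup>-\<^sup>1 r\<close>, up to words with fewer occurrences of \<open>y\<close> (lemma
  \<open>dcontr_power\<close>).  If no \<open>q\<close>-integer vanishes, applying the operator \<open>m\<close> times isolates the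
  monomials of the highest degree \<open>m\<close> in \<open>y\<close>, strips off the power of \<open>y\<close>, and leaves a relation
  between monomials in the later letters.  This is the induction in
  \<open>monomials_independent_mod_Fil\<close>; the inductive predicate \<open>admissible\<close> records what it needs of the
  letters.

  To find admissible letters, two cases are distinguished.  If for some \<open>y\<close> in some \<open>P\<^sub>g\<close> no
  \<open>T\<^sub>g\<^sup>i y\<close> depends, modulo \<open>C\<^sub>0\<close>, on the later members of its orbit, then
  \<open>y, T\<^sub>g y, \<dots>, T\<^sub>g\<^sup>d\<^sup>-\<^sup>1 y\<close> is an admissible list with \<open>q = 0\<close>, because each letter is mapped to a later
  one; so \<open>d\<close> is arbitrary.  Otherwise every element of \<open>P\<^sub>g\<close> is annihilated modulo \<open>C\<^sub>0\<close> by a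
  nonzero polynomial in \<open>T\<^sub>g\<close>, and since the field is algebraically closed, \<open>P\<^sub>g\<close> is spanned by
  generalized eigenvectors modulo \<open>C\<^sub>0\<close>.  Those whose eigenvalue is a root of unity different from
  1 lie in \<open>C\<^sub>0 + Y\<close>.  As long as a space \<open>X\<close> that contains \<open>C\<^sub>0 + Y\<close> does not contain \<open>Z\<close>, some
  generalized eigenvector for another eigenvalue \<open>q\<close> is outside \<open>X\<close>, and the last member outside
  \<open>X\<close> of its chain under \<open>T\<^sub>g - q\<close> is a new letter; no \<open>q\<close>-integer vanishes because \<open>q\<close> is 1, in
  characteristic zero, or not a root of unity (lemmas \<open>admissible_extend\<close> and \<open>exists_admissible\<close>).
\<close>

section \<open>Tensors as formal sums\<close>

interpretation free: vector_space "fscale :: 'k::field \<Rightarrow> ('a \<Rightarrow>\<^sub>0 'k) \<Rightarrow> ('a \<Rightarrow>\<^sub>0 'k)"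
  by (rule vector_space_fscale)

context vector_space
begin

lemma lin_extend_superset:
  assumes "finite A" "Poly_Mapping.keys t \<subseteq> A"
  shows "lin_extend scale f t = (\<Sum>p\<in>A. scale (Poly_Mapping.lookup t p) (f p))"
  unfolding lin_extend_def using assms
  by (intro sum.mono_neutral_left) (auto simp: in_keys_iff)

lemma lin_extend_add: "lin_extend scale f (t + u) = lin_extend scale f t + lin_extend scale f u"
proof -
  let ?A = "Poly_Mapping.keys t \<union> Poly_Mapping.keys u"
  have "finite ?A" "Poly_Mapping.keys (t + u) \<subseteq> ?A"
    using Poly_Mapping.keys_add[of t u] by auto
  then show ?thesis
    by (simp add: lin_extend_superset[of ?A] lookup_add scale_left_distrib sum.distrib)
qed

lemma lin_extend_fscale: "lin_extend scale f (fscale c t) = scale c (lin_extend scale f t)"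
proof -
  have "Poly_Mapping.keys (fscale c t) \<subseteq> Poly_Mapping.keys t"
    by (auto simp: in_keys_iff lookup_fscale)
  then show ?thesis
    by (simp add: lin_extend_superset[of "Poly_Mapping.keys t"] lookup_fscale scale_sum_right)
qed

lemma linear_lin_extend: "Vector_Spaces.linear fscale scale (lin_extend scale f)"
  by (simp add: Vector_Spaces.linear_iff lin_extend_add lin_extend_fscale
      vector_space_fscale vector_space_axioms)

lemma lin_extend_diff: "lin_extend scale f (t - u) = lin_extend scale f t - lin_extend scale f u"
  by (metis lin_extend_add diff_add_cancel add_diff_cancel_right')

lemma lin_extend_pure [simp]: "lin_extend scale f (pure p) = f p"
  by (simp add: lin_extend_def pure_def)

lemma lin_extend_fun_add:
  "lin_extend scale (\<lambda>p. f p + g p) t = lin_extend scale f t + lin_extend scale g t"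
  by (simp add: lin_extend_def scale_right_distrib sum.distrib)

lemma lin_extend_fun_diff:
  "lin_extend scale (\<lambda>p. f p - g p) t = lin_extend scale f t - lin_extend scale g t"
  by (simp add: lin_extend_def scale_right_diff_distrib sum_subtractf)

lemma lin_extend_fun_scale:
  "lin_extend scale (\<lambda>p. scale c (f p)) t = scale c (lin_extend scale f t)"
  by (simp add: lin_extend_def scale_sum_right mult.commute)

lemma lin_extend_mem:
  assumes "subspace N" "\<And>p. f p \<in> N"
  shows "lin_extend scale f t \<in> N"
  unfolding lin_extend_def using assms by (intro subspace_sum subspace_scale) auto

lemma lin_extend_lin_extend:
  "lin_extend scale f (lin_extend fscale G t) = lin_extend scale (\<lambda>p. lin_extend scale f (G p)) t"
proof -
  interpret L: Vector_Spaces.linear fscale scale "lin_extend scale f" by (rule linear_lin_extend)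
  show ?thesis by (simp add: lin_extend_def[of fscale] lin_extend_def[of scale _ t] L.sum L.scale)
qed

text \<open>
  A map that is bilinear modulo \<open>N\<close> induces a linear map from the tensor product to the quotient by
  \<open>N\<close>.  Taking \<open>N = {0}\<close> shows that tensors can be contracted, taking for \<open>N\<close> the multilinearity
  relations shows that tensors can be multiplied.
\<close>

lemma lin_extend_tensor2_null_mem:
  assumes N: "subspace N"
    and "\<And>a a' b. f (a + a', b) - f (a, b) - f (a', b) \<in> N"
    and "\<And>a b b'. f (a, b + b') - f (a, b) - f (a, b') \<in> N"
    and "\<And>c a b. f (s c a, b) - scale c (f (a, b)) \<in> N"
    and "\<And>c a b. f (a, s c b) - scale c (f (a, b)) \<in> N"
    and t: "t \<in> tensor2_null s"
  shows "lin_extend scale f t \<in> N"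
proof -
  interpret L: Vector_Spaces.linear fscale scale "lin_extend scale f" by (rule linear_lin_extend)
  have "tensor2_null s \<subseteq> {t. lin_extend scale f t \<in> N}"
    unfolding tensor2_null_def
    by (rule free.span_minimal[OF _ L.subspace_linear_preimage[OF N]])
      (use assms in \<open>auto simp: lin_extend_diff lin_extend_fscale\<close>)
  with t show ?thesis by auto
qed

end

context assoc_algebra
begin

lemma subspace_tensor2_null: "free.subspace (tensor2_null scale)"
  unfolding tensor2_null_def by (rule free.subspace_span)

lemma tensor2_null_relations:
  "pure (a + a', b) - pure (a, b) - pure (a', b) \<in> tensor2_null scale"
  "pure (a, b + b') - pure (a, b) - pure (a, b') \<in> tensor2_null scale"
  "pure (scale c a, b) - fscale c (pure (a, b)) \<in> tensor2_null scale"
  "pure (a, scale c b) - fscale c (pure (a, b)) \<in> tensor2_null scale"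
  unfolding tensor2_null_def by (rule free.span_base; blast)+

lemma tensor2_eq_refl [simp]: "tensor2_eq scale t t"
  by (simp add: tensor2_eq_def free.subspace_0[OF subspace_tensor2_null])

lemma tensor2_eq_sym: "tensor2_eq scale t u \<Longrightarrow> tensor2_eq scale u t"
  using free.subspace_neg[OF subspace_tensor2_null] by (fastforce simp: tensor2_eq_def)

lemma tensor2_eq_trans [trans]:
  "tensor2_eq scale t u \<Longrightarrow> tensor2_eq scale u v \<Longrightarrow> tensor2_eq scale t v"
  using free.subspace_add[OF subspace_tensor2_null, of "t - u" "u - v"] by (simp add: tensor2_eq_def)

lemma tensor2_eq_add:
  "tensor2_eq scale t u \<Longrightarrow> tensor2_eq scale t' u' \<Longrightarrow> tensor2_eq scale (t + t') (u + u')"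
  using free.subspace_add[OF subspace_tensor2_null, of "t - u" "t' - u'"]
  by (simp add: tensor2_eq_def algebra_simps)

lemma tensor2_eq_fscale: "tensor2_eq scale t u \<Longrightarrow> tensor2_eq scale (fscale c t) (fscale c u)"
  using free.subspace_scale[OF subspace_tensor2_null, of "t - u" c]
  by (simp add: tensor2_eq_def free.scale_right_diff_distrib)

lemma tensor2_mult_add_left: "tensor2_mult (t + t') u = tensor2_mult t u + tensor2_mult t' u"
  unfolding tensor2_mult_def by (rule free.lin_extend_add)

lemma tensor2_mult_add_right: "tensor2_mult t (u + u') = tensor2_mult t u + tensor2_mult t u'"
  unfolding tensor2_mult_def
  by (simp add: free.lin_extend_add case_prod_unfold free.lin_extend_fun_add)

lemma tensor2_mult_pure [simp]: "tensor2_mult (pure (a, b)) (pure (c, d)) = pure (a * c, b * d)"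
  unfolding tensor2_mult_def by simp

lemma tensor2_mult_null_left:
  assumes "t \<in> tensor2_null scale"
  shows "tensor2_mult t u \<in> tensor2_null scale"
  unfolding tensor2_mult_def
  by (rule free.lin_extend_tensor2_null_mem[OF subspace_tensor2_null _ _ _ _ assms];
      simp only: prod.case free.lin_extend_fun_diff[symmetric] free.lin_extend_fun_scale[symmetric];
      rule free.lin_extend_mem[OF subspace_tensor2_null])
    (auto simp: distrib_right scale_mult_left[symmetric] tensor2_null_relations)

lemma tensor2_mult_null_right:
  assumes "u \<in> tensor2_null scale"
  shows "tensor2_mult t u \<in> tensor2_null scale"
  unfolding tensor2_mult_def
  apply (rule free.lin_extend_mem[OF subspace_tensor2_null])
  apply (simp only: case_prod_unfold)
  by (rule free.lin_extend_tensor2_null_mem[OF subspace_tensor2_null _ _ _ _ assms])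
    (auto simp: distrib_left scale_mult_right[symmetric] tensor2_null_relations)

lemma tensor2_mult_cong:
  assumes "tensor2_eq scale t t'" "tensor2_eq scale u u'"
  shows "tensor2_eq scale (tensor2_mult t u) (tensor2_mult t' u')"
proof -
  have "tensor2_mult t u - tensor2_mult t' u' = tensor2_mult (t - t') u + tensor2_mult t' (u - u')"
    using tensor2_mult_add_left[of "t - t'" t' u] tensor2_mult_add_right[of t' "u - u'" u']
    by (simp add: algebra_simps)
  moreover have "tensor2_mult (t - t') u + tensor2_mult t' (u - u') \<in> tensor2_null scale"
    using assms unfolding tensor2_eq_def
    by (intro free.subspace_add[OF subspace_tensor2_null] tensor2_mult_null_left tensor2_mult_null_right)
  ultimately show ?thesis by (simp add: tensor2_eq_def)
qed

lemma vector_space_itself: "vector_space ((*) :: 'k \<Rightarrow> 'k \<Rightarrow> 'k)"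
  by unfold_locales (simp_all add: algebra_simps)

abbreviation functional :: "('h \<Rightarrow> 'k) \<Rightarrow> bool" where
  "functional \<equiv> Vector_Spaces.linear scale (*)"

lemma functional_iff:
  "functional f \<longleftrightarrow> (\<forall>x y. f (x + y) = f x + f y) \<and> (\<forall>c x. f (scale c x) = c * f x)"
  by (simp add: Vector_Spaces.linear_iff vector_space_axioms
      vector_space_itself)

lemma functionalD:
  assumes "functional f"
  shows "f (x + y) = f x + f y" "f (scale c x) = c * f x"
  using assms by (auto simp: functional_iff)

lemma functional_mult_left: "functional f \<Longrightarrow> functional (\<lambda>z. f (a * z))"
  by (simp add: functional_iff distrib_left scale_mult_right[symmetric])

lemma functional_vanishing_subspace: "functional f \<Longrightarrow> subspace {x. f x = 0}"
  by (rule subspaceI) (auto simp: functionalD, metis functionalD(2) mult_zero_left scale_zero_left)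

lemma functional_vanishes_on_span:
  assumes "functional f" "\<And>x. x \<in> S \<Longrightarrow> f x = 0" "x \<in> span S"
  shows "f x = 0"
  using span_minimal[of S "{x. f x = 0}"] functional_vanishing_subspace[OF assms(1)] assms by auto

lemma exists_functional_on_independent:
  assumes "independent B"
  shows "\<exists>f. functional f \<and> (\<forall>x\<in>B. f x = g x)"
proof -
  interpret vp: vector_space_pair scale "(*) :: 'k \<Rightarrow> 'k \<Rightarrow> 'k"
    by (simp add: vector_space_pair_def vector_space_axioms
        vector_space_itself)
  show ?thesis by (rule vp.linear_independent_extend[OF assms])
qed

text \<open>
  A basis of \<open>X\<close> stays independent when \<open>y\<close> is added to it, so values can be prescribed on it.
\<close>

lemma exists_functional_separating:
  assumes "subspace X" "y \<notin> X"
  shows "\<exists>f. functional f \<and> (\<forall>x\<in>X. f x = 0) \<and> f y = 1"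
proof -
  obtain B where B: "B \<subseteq> X" "independent B" "X \<subseteq> span B"
    using maximal_independent_subset by blast
  have "y \<notin> span B" using assms B by (metis span_minimal subsetD)
  then have "independent (insert y B)" using B by (simp add: independent_insertI)
  then obtain f where f: "functional f" "\<forall>x\<in>insert y B. f x = (if x = y then 1 else 0)"
    using exists_functional_on_independent[of "insert y B" "\<lambda>x. if x = y then 1 else 0"] by blast
  have "f x = 0" if "x \<in> X" for x
    by (rule functional_vanishes_on_span[OF f(1), of B]) (use f that B assms in auto)
  then show ?thesis using f by auto
qed

lemma lin_extend_bilinear_eq:
  assumes "\<And>a a' b. f (a + a', b) = f (a, b) + f (a', b)"
    and "\<And>a b b'. f (a, b + b') = f (a, b) + f (a, b')"
    and "\<And>c a b. f (scale c a, b) = scale c (f (a, b))"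
    and "\<And>c a b. f (a, scale c b) = scale c (f (a, b))"
    and "tensor2_eq scale t u"
  shows "lin_extend scale f t = lin_extend scale f u"
  using lin_extend_tensor2_null_mem[of "{0}" f scale "t - u"] assms
  by (simp add: tensor2_eq_def lin_extend_diff)

lemma mult_mem_of_span:
  assumes "subspace N" "\<And>x. x \<in> S \<Longrightarrow> a * x \<in> N" "x \<in> span S"
  shows "a * x \<in> N"
proof -
  have "subspace {x. a * x \<in> N}"
    using assms(1) by (auto intro!: subspaceI
      simp: subspace_0 distrib_left subspace_add scale_mult_right[symmetric] subspace_scale)
  then show ?thesis using span_minimal[of S "{x. a * x \<in> N}"] assms by auto
qed

lemma mult_mem_of_span_left:
  assumes "subspace N" "\<And>x. x \<in> S \<Longrightarrow> x * a \<in> N" "x \<in> span S"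
  shows "x * a \<in> N"
proof -
  have "subspace {x. x * a \<in> N}"
    using assms(1) by (auto intro!: subspaceI
      simp: subspace_0 distrib_right subspace_add scale_mult_left[symmetric] subspace_scale)
  then show ?thesis using span_minimal[of S "{x. x * a \<in> N}"] assms by auto
qed

end

section \<open>Contractions of the comultiplication\<close>

context hopf_algebra
begin

text \<open>
  In Sweedler notation, \<open>rcontr f x\<close> is \<open>x\<^sub>1 f(x\<^sub>2)\<close> and \<open>lcontr f x\<close> is \<open>f(x\<^sub>1) x\<^sub>2\<close>.
\<close>

definition rcontr :: "('h \<Rightarrow> 'k) \<Rightarrow> 'h \<Rightarrow> 'h" where
  "rcontr f x = lin_extend scale (\<lambda>(a, b). scale (f b) a) (comult x)"

definition lcontr :: "('h \<Rightarrow> 'k) \<Rightarrow> 'h \<Rightarrow> 'h" where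
  "lcontr f x = lin_extend scale (\<lambda>(a, b). scale (f a) b) (comult x)"

lemma rcontr_eqI:
  assumes "functional f" "tensor2_eq scale (comult x) t"
  shows "rcontr f x = lin_extend scale (\<lambda>(a, b). scale (f b) a) t"
  unfolding rcontr_def using assms(1)
  by (intro lin_extend_bilinear_eq assms(2))
    (auto simp: functionalD scale_left_distrib scale_right_distrib mult.commute)

lemma lcontr_eqI:
  assumes "functional f" "tensor2_eq scale (comult x) t"
  shows "lcontr f x = lin_extend scale (\<lambda>(a, b). scale (f a) b) t"
  unfolding lcontr_def using assms(1)
  by (intro lin_extend_bilinear_eq assms(2))
    (auto simp: functionalD scale_left_distrib scale_right_distrib mult.commute)

lemma rcontr_add: "functional f \<Longrightarrow> rcontr f (x + y) = rcontr f x + rcontr f y"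
  by (simp add: rcontr_eqI[OF _ comult_add] lin_extend_add rcontr_def[symmetric])

lemma rcontr_scale: "functional f \<Longrightarrow> rcontr f (scale c x) = scale c (rcontr f x)"
  by (simp add: rcontr_eqI[OF _ comult_scale] lin_extend_fscale rcontr_def[symmetric])

lemma lcontr_add: "functional f \<Longrightarrow> lcontr f (x + y) = lcontr f x + lcontr f y"
  by (simp add: lcontr_eqI[OF _ comult_add] lin_extend_add lcontr_def[symmetric])

lemma lcontr_scale: "functional f \<Longrightarrow> lcontr f (scale c x) = scale c (lcontr f x)"
  by (simp add: lcontr_eqI[OF _ comult_scale] lin_extend_fscale lcontr_def[symmetric])

lemma linear_rcontr: "functional f \<Longrightarrow> Vector_Spaces.linear scale scale (rcontr f)"
  by (simp add: Vector_Spaces.linear_iff vector_space_axioms rcontr_add rcontr_scale)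

lemma linear_lcontr: "functional f \<Longrightarrow> Vector_Spaces.linear scale scale (lcontr f)"
  by (simp add: Vector_Spaces.linear_iff vector_space_axioms lcontr_add lcontr_scale)

lemma rcontr_fun_add: "rcontr (\<lambda>z. f z + g z) x = rcontr f x + rcontr g x"
  by (simp add: rcontr_def scale_left_distrib case_prod_unfold lin_extend_fun_add)

lemma rcontr_fun_scale: "rcontr (\<lambda>z. c * f z) x = scale c (rcontr f x)"
  by (simp add: rcontr_def case_prod_unfold lin_extend_fun_scale flip: scale_scale)

text \<open>
  Multiplicativity of \<open>\<Delta>\<close> gives \<open>(x y)\<^sub>1 f((x y)\<^sub>2) = x\<^sub>1 y\<^sub>1 f(x\<^sub>2 y\<^sub>2)\<close>, and for a fixed term
  \<open>a \<otimes> b\<close> of \<open>\<Delta> x\<close> the sum over \<open>\<Delta> y\<close> is a contraction of \<open>y\<close> against \<open>z \<mapsto> f(b z)\<close>.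
\<close>

lemma rcontr_mult:
  assumes f: "functional f" and t: "tensor2_eq scale (comult x) t"
  shows "rcontr f (x * y) = lin_extend scale (\<lambda>(a, b). a * rcontr (\<lambda>z. f (b * z)) y) t"
proof -
  have inner: "lin_extend scale (\<lambda>(c, d). scale (f (b * d)) (a * c)) (comult y) =
      a * rcontr (\<lambda>z. f (b * z)) y" for a b
    by (simp add: rcontr_def lin_extend_def sum_distrib_left case_prod_unfold
        scale_mult_right[symmetric])
  have "rcontr f (x * y) =
      lin_extend scale (\<lambda>(a, b). scale (f b) a) (tensor2_mult (comult x) (comult y))"
    by (rule rcontr_eqI[OF f comult_mult])
  also have "\<dots> = lin_extend scale (\<lambda>(a, b). a * rcontr (\<lambda>z. f (b * z)) y) (comult x)"
    unfolding tensor2_mult_def lin_extend_lin_extend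
    by (rule arg_cong[of _ _ "\<lambda>g. lin_extend scale g (comult x)"])
      (simp add: fun_eq_iff lin_extend_lin_extend case_prod_unfold inner[unfolded case_prod_unfold])
  also have "\<dots> = lin_extend scale (\<lambda>(a, b). a * rcontr (\<lambda>z. f (b * z)) y) t"
    by (rule lin_extend_bilinear_eq[OF _ _ _ _ t])
      (simp_all add: distrib_right distrib_left functionalD[OF f] rcontr_fun_add
        scale_mult_left[symmetric] scale_mult_right[symmetric] rcontr_fun_scale)
  finally show ?thesis .
qed

end

section \<open>Group-like elements\<close>

context hopf_algebra
begin

lemma grouplikeD:
  assumes "grouplike g"
  shows "g \<noteq> 0" "tensor2_eq scale (comult g) (pure (g, g))"
  using assms by (auto simp: grouplike_def)

lemma rcontr_grouplike: "functional f \<Longrightarrow> grouplike g \<Longrightarrow> rcontr f g = scale (f g) g"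
  by (simp add: rcontr_eqI[OF _ grouplikeD(2)])

lemma lcontr_grouplike: "functional f \<Longrightarrow> grouplike g \<Longrightarrow> lcontr f g = scale (f g) g"
  by (simp add: lcontr_eqI[OF _ grouplikeD(2)])

lemma grouplike_one [simp]: "grouplike 1"
  by (simp add: grouplike_def comult_one)

lemma rcontr_one: "functional f \<Longrightarrow> rcontr f 1 = scale (f 1) 1"
  by (simp add: rcontr_grouplike)

lemma counit_grouplike: "grouplike g \<Longrightarrow> counit g = 1"
  using counit_left[of g, folded lcontr_def] lcontr_grouplike[OF counit_linear, of g]
  by (metis grouplikeD(1) scale_one scale_cancel_right)

lemma grouplike_mult:
  assumes "grouplike g" "grouplike h"
  shows "grouplike (g * h)"
proof -
  have "counit (g * h) = 1" using assms by (simp add: counit_mult counit_grouplike)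
  moreover have "counit 0 = 0"
    using functionalD(2)[OF counit_linear, of 0 0] by simp
  ultimately have "g * h \<noteq> 0" by auto
  moreover have "tensor2_eq scale (comult (g * h)) (pure (g * h, g * h))"
    using tensor2_eq_trans[OF comult_mult tensor2_mult_cong[OF grouplikeD(2) grouplikeD(2)]] assms
    by simp
  ultimately show ?thesis by (simp add: grouplike_def)
qed

lemma antipode_grouplike:
  assumes "grouplike g"
  shows "antipode g * g = 1" "g * antipode g = 1"
proof -
  have S: "antipode (x + y) = antipode x + antipode y" "antipode (scale c x) = scale c (antipode x)"
    for x y c using antipode_linear by (simp_all add: Vector_Spaces.linear_iff)
  have "lin_extend scale (\<lambda>(a, b). antipode a * b) (comult g) =
      lin_extend scale (\<lambda>(a, b). antipode a * b) (pure (g, g))"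
    by (rule lin_extend_bilinear_eq[OF _ _ _ _ grouplikeD(2)[OF assms]])
      (simp_all add: S distrib_left distrib_right scale_mult_left[symmetric] scale_mult_right[symmetric])
  then show "antipode g * g = 1" by (simp add: antipode_left counit_grouplike[OF assms])
  have "lin_extend scale (\<lambda>(a, b). a * antipode b) (comult g) =
      lin_extend scale (\<lambda>(a, b). a * antipode b) (pure (g, g))"
    by (rule lin_extend_bilinear_eq[OF _ _ _ _ grouplikeD(2)[OF assms]])
      (simp_all add: S distrib_left distrib_right scale_mult_left[symmetric] scale_mult_right[symmetric])
  then show "g * antipode g = 1" by (simp add: antipode_right counit_grouplike[OF assms])
qed

lemma tensor2_mult_assoc_pure:
  "tensor2_mult (pure (a, b)) (tensor2_mult (pure (c, d)) t) = tensor2_mult (pure (a * c, b * d)) t"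
  unfolding tensor2_mult_def
  by (simp add: free.lin_extend_lin_extend case_prod_unfold mult.assoc)

lemma lin_extend_pure_id: "lin_extend fscale pure t = t"
proof (rule poly_mapping_eqI)
  fix p
  have "Poly_Mapping.lookup (lin_extend fscale pure t) p =
      (\<Sum>x\<in>Poly_Mapping.keys t. Poly_Mapping.lookup t x * (if x = p then 1 else 0))"
    by (simp add: lin_extend_def lookup_sum lookup_fscale pure_def lookup_single when_def)
  also have "\<dots> = Poly_Mapping.lookup t p"
    by (simp add: in_keys_iff if_distrib sum.delta cong: if_cong)
  finally show "Poly_Mapping.lookup (lin_extend fscale pure t) p = Poly_Mapping.lookup t p" .
qed

lemma tensor2_mult_one_left: "tensor2_mult (pure (1, 1)) t = t"
  unfolding tensor2_mult_def by (simp add: case_prod_unfold lin_extend_pure_id)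

text \<open>
  \<open>S\<close> denotes the antipode.  Multiplying \<open>1 \<otimes> 1 = \<Delta>(g S(g)) = (g \<otimes> g) \<Delta>(S(g))\<close> from the left by
  \<open>S(g) \<otimes> S(g)\<close> leaves \<open>\<Delta>(S(g))\<close> on the right.
\<close>

lemma grouplike_antipode:
  assumes g: "grouplike g"
  shows "grouplike (antipode g)"
proof -
  let ?h = "antipode g"
  note inv = antipode_grouplike[OF g]
  have "?h \<noteq> 0" using inv(1) by auto
  moreover have "tensor2_eq scale (comult ?h) (pure (?h, ?h))"
  proof -
    have "tensor2_eq scale (pure (1, 1)) (comult (g * ?h))"
      using tensor2_eq_sym[OF comult_one] inv by simp
    also have "tensor2_eq scale (comult (g * ?h)) (tensor2_mult (pure (g, g)) (comult ?h))"
      using tensor2_eq_trans[OF comult_mult tensor2_mult_cong[OF grouplikeD(2)[OF g] tensor2_eq_refl]] .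
    finally have "tensor2_eq scale (tensor2_mult (pure (?h, ?h)) (pure (1, 1)))
        (tensor2_mult (pure (?h, ?h)) (tensor2_mult (pure (g, g)) (comult ?h)))"
      by (intro tensor2_mult_cong) simp_all
    then show ?thesis
      by (simp add: tensor2_mult_assoc_pure inv tensor2_mult_one_left tensor2_eq_sym)
  qed
  ultimately show ?thesis by (simp add: grouplike_def)
qed

lemma group_grouplike_group: "group grouplike_group"
  by (rule groupI)
    (auto simp: grouplike_group_def grouplike_mult mult.assoc
      intro: grouplike_antipode antipode_grouplike)

abbreviation ginv :: "'h \<Rightarrow> 'h" where
  "ginv g \<equiv> inv\<^bsub>grouplike_group\<^esub> g"

lemma ginv:
  assumes "grouplike g"
  shows "grouplike (ginv g)" "ginv g * g = 1" "g * ginv g = 1"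
    "ginv g * (g * x) = x" "g * (ginv g * x) = x"
proof -
  interpret G: group grouplike_group by (rule group_grouplike_group)
  have "g \<in> carrier grouplike_group" using assms by (simp add: grouplike_group_def)
  from G.inv_closed[OF this] G.l_inv[OF this] G.r_inv[OF this]
  show "grouplike (ginv g)" "ginv g * g = 1" "g * ginv g = 1"
    by (simp_all add: grouplike_group_def)
  then show "ginv g * (g * x) = x" "g * (ginv g * x) = x"
    by (simp_all flip: mult.assoc)
qed

text \<open>
  A contraction against \<open>f\<close> multiplies every group-like element by its value under \<open>f\<close>.  If
  \<open>g = \<Sum> c\<^sub>b b\<close> with independent group-like \<open>b\<close>, contracting against the functional that picks out
  \<open>c\<^sub>b\<close> gives \<open>c\<^sub>b g = c\<^sub>b b\<close>, so all coefficients vanish unless \<open>g\<close> is one of the \<open>b\<close>.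
\<close>

lemma independent_grouplike: "independent (Collect grouplike)"
proof -
  have fin: "independent B" if "finite B" "B \<subseteq> Collect grouplike" for B
    using that
  proof (induction B rule: finite_induct)
    case (insert g B)
    then have B: "independent B" by simp
    have "g \<notin> span B"
    proof
      assume "g \<in> span B"
      then obtain c where c: "g = (\<Sum>b\<in>B. scale (c b) b)"
        using insert.hyps by (auto simp: span_finite)
      have "c b = 0" if b: "b \<in> B" for b
      proof -
        obtain f where f: "functional f" "\<forall>x\<in>B. f x = (if x = b then 1 else 0)"
          using exists_functional_on_independent[OF B, of "\<lambda>x. if x = b then 1 else 0"] by blast
        interpret f: Vector_Spaces.linear scale "(*)" f by (rule f(1))
        interpret r: Vector_Spaces.linear scale scale "rcontr f" by (rule linear_rcontr[OF f(1)])
        have "f g = (\<Sum>x\<in>B. if x = b then c b else 0)"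
          unfolding c f.sum f.scale using f(2) by (intro sum.cong) auto
        then have fg: "f g = c b" using b insert.hyps by (simp add: sum.delta)
        have "rcontr f g = (\<Sum>x\<in>B. scale (c x) (rcontr f x))"
          unfolding c r.sum r.scale ..
        also have "\<dots> = (\<Sum>x\<in>B. if x = b then scale (c b) b else 0)"
          using f insert.prems by (intro sum.cong) (auto simp: rcontr_grouplike)
        also have "\<dots> = scale (c b) b"
          using b insert.hyps by (simp add: sum.delta)
        finally have "scale (c b) g = scale (c b) b"
          using insert.prems f fg by (simp add: rcontr_grouplike)
        then show "c b = 0" using b insert.hyps by auto
      qed
      then have "g = 0" using c by simp
      then show False using insert.prems grouplikeD(1) by auto
    qed
    then show ?case using B by (simp add: independent_insertI)
  qed (simp add: independent_empty)
  show ?thesis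
    unfolding independent_explicit_finite_subsets
    using fin independentD by (metis subset_refl)
qed

lemma exists_coefficient_functional:
  assumes "grouplike g"
  shows "\<exists>f. functional f \<and> (\<forall>h. grouplike h \<longrightarrow> f h = (if h = g then 1 else 0))"
  using exists_functional_on_independent[OF independent_grouplike, of "\<lambda>h. if h = g then 1 else 0"]
  by auto

end

section \<open>Skew primitive elements and the word filtration\<close>

context hopf_algebra
begin


text \<open>
  In contrast to \<open>skew_primitive\<close>, zero is included, so that this is a subspace.
\<close>

definition skew_space :: "'h \<Rightarrow> 'h set" where
  "skew_space g = {y. tensor2_eq scale (comult y) (pure (y, 1) + pure (g, y))}"

definition conj_by :: "'h \<Rightarrow> 'h \<Rightarrow> 'h" where
  "conj_by g x = ginv g * x * g"

lemma skew_primitive_iff: "skew_primitive g y \<longleftrightarrow> y \<noteq> 0 \<and> grouplike g \<and> y \<in> skew_space g"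
  by (simp add: skew_primitive_def skew_space_def)

lemma tensor2_eq_relations:
  "tensor2_eq scale (pure (a + a', b)) (pure (a, b) + pure (a', b))"
  "tensor2_eq scale (pure (a, b + b')) (pure (a, b) + pure (a, b'))"
  "tensor2_eq scale (pure (scale c a, b)) (fscale c (pure (a, b)))"
  "tensor2_eq scale (pure (a, scale c b)) (fscale c (pure (a, b)))"
  using tensor2_null_relations by (simp_all add: tensor2_eq_def diff_diff_eq)

lemma subspace_skew_space: "subspace (skew_space g)"
proof (rule subspaceI)
  have scal: "scale c x \<in> skew_space g" if "x \<in> skew_space g \<or> c = 0" for c x
  proof -
    have "tensor2_eq scale (comult (scale c x)) (fscale c (comult x))" by (rule comult_scale)
    also have "tensor2_eq scale (fscale c (comult x)) (fscale c (pure (x, 1) + pure (g, x)))"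
      using that tensor2_eq_fscale by (auto simp: skew_space_def)
    also have "fscale c (pure (x, 1) + pure (g, x)) = fscale c (pure (x, 1)) + fscale c (pure (g, x))"
      by (rule free.scale_right_distrib)
    also have "tensor2_eq scale \<dots> (pure (scale c x, 1) + pure (g, scale c x))"
      by (intro tensor2_eq_add tensor2_eq_sym[OF tensor2_eq_relations(3)]
          tensor2_eq_sym[OF tensor2_eq_relations(4)])
    finally show ?thesis by (simp add: skew_space_def)
  qed
  show "0 \<in> skew_space g" using scal[of 0 0] by simp
  show "scale c x \<in> skew_space g" if "x \<in> skew_space g" for c x using scal that by simp
  fix x y assume "x \<in> skew_space g" "y \<in> skew_space g"
  then have "tensor2_eq scale (comult x + comult y)
      ((pure (x, 1) + pure (g, x)) + (pure (y, 1) + pure (g, y)))"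
    by (intro tensor2_eq_add) (auto simp: skew_space_def)
  also have "(pure (x, 1) + pure (g, x)) + (pure (y, 1) + pure (g, y)) =
      (pure (x, 1) + pure (y, 1)) + (pure (g, x) + pure (g, y) :: 'h \<times> 'h \<Rightarrow>\<^sub>0 'k)"
    by (simp add: algebra_simps)
  also have "tensor2_eq scale \<dots> (pure (x + y, 1) + pure (g, x + y))"
    by (intro tensor2_eq_add tensor2_eq_sym[OF tensor2_eq_relations(1)]
        tensor2_eq_sym[OF tensor2_eq_relations(2)])
  finally show "x + y \<in> skew_space g"
    using tensor2_eq_trans[OF comult_add] by (simp add: skew_space_def)
qed

lemma rcontr_grouplike_mult:
  assumes "functional f" "grouplike h"
  shows "rcontr f (h * x) = h * rcontr (\<lambda>z. f (h * z)) x"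
  by (simp add: rcontr_mult[OF assms(1) grouplikeD(2)[OF assms(2)]])

lemma rcontr_skew_mult:
  assumes "functional f" "e \<in> skew_space g"
  shows "rcontr f (e * x) = e * rcontr f x + g * rcontr (\<lambda>z. f (e * z)) x"
  using rcontr_mult[OF assms(1), of e "pure (e, 1) + pure (g, e)" x] assms(2)
  by (simp add: skew_space_def lin_extend_add)

lemma lcontr_skew:
  assumes "functional f" "e \<in> skew_space g"
  shows "lcontr f e = scale (f e) 1 + scale (f g) e"
  using lcontr_eqI[OF assms(1), of e "pure (e, 1) + pure (g, e)"] assms(2)
  by (simp add: skew_space_def lin_extend_add)

text \<open>
  Conjugate \<open>\<Delta> e = e \<otimes> 1 + g \<otimes> e\<close> by \<open>h \<otimes> h\<close>.
\<close>

lemma conj_skew: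
  assumes "grouplike h" "e \<in> skew_space g"
  shows "conj_by h e \<in> skew_space (ginv h * g * h)"
proof -
  let ?i = "ginv h"
  have "tensor2_eq scale (comult (?i * e)) (tensor2_mult (pure (?i, ?i)) (pure (e, 1) + pure (g, e)))"
    by (rule tensor2_eq_trans[OF comult_mult tensor2_mult_cong[OF grouplikeD(2)[OF ginv(1)]]])
      (use assms in \<open>auto simp: skew_space_def\<close>)
  then have "tensor2_eq scale (comult (?i * e * h))
      (tensor2_mult (tensor2_mult (pure (?i, ?i)) (pure (e, 1) + pure (g, e))) (pure (h, h)))"
    by (rule tensor2_eq_trans[OF comult_mult tensor2_mult_cong[OF _ grouplikeD(2)[OF assms(1)]]])
  then show ?thesis
    by (simp add: skew_space_def conj_by_def tensor2_mult_add_left tensor2_mult_add_right ginv assms)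
qed

lemma conj_skew_self: "grouplike g \<Longrightarrow> e \<in> skew_space g \<Longrightarrow> conj_by g e \<in> skew_space g"
  using conj_skew[of g e g] by (simp add: ginv)

lemma linear_conj_by: "Vector_Spaces.linear scale scale (conj_by g)"
  by (simp add: Vector_Spaces.linear_iff vector_space_axioms conj_by_def distrib_left distrib_right
      scale_mult_left[symmetric] scale_mult_right[symmetric])

definition letters :: "'h set" where
  "letters = {e. \<exists>g. grouplike g \<and> e \<in> skew_space g}"

text \<open>
  The filtration by the number of skew primitive letters.  The bound is strict, so that \<open>Fil 0 = {0}\<close>
  and \<open>Fil 1 = C0\<close>: an operator that deletes a letter then annihilates \<open>C0\<close> without a special case.
\<close>

definition Fil :: "nat \<Rightarrow> 'h set" where
  "Fil n = span {h * prod_list es | h es. grouplike h \<and> set es \<subseteq> letters \<and> length es < n}"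

definition words :: "nat \<Rightarrow> 'h set" where
  "words n = span {prod_list es | es. set es \<subseteq> letters \<and> length es = n}"

lemma subspace_Fil [simp]: "subspace (Fil n)" and subspace_words [simp]: "subspace (words n)"
  by (simp_all add: Fil_def words_def)

lemma Fil_0 [simp]: "Fil 0 = {0}"
  by (simp add: Fil_def)

lemma Fil_mono: "m \<le> n \<Longrightarrow> x \<in> Fil m \<Longrightarrow> x \<in> Fil n"
  unfolding Fil_def by (erule subsetD[OF span_mono, rotated]) (use order_less_le_trans in blast)

lemma Fil_base: "grouplike h \<Longrightarrow> set es \<subseteq> letters \<Longrightarrow> length es < n \<Longrightarrow> h * prod_list es \<in> Fil n"
  unfolding Fil_def by (rule span_base) blast

lemma Fil_grouplike_mult:
  assumes "grouplike h" "x \<in> Fil n"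
  shows "h * x \<in> Fil n"
  by (rule mult_mem_of_span[OF _ _ assms(2)[unfolded Fil_def]])
    (use assms(1) in \<open>auto simp: grouplike_mult Fil_base simp flip: mult.assoc\<close>)

text \<open>
  A letter passes a group-like element from left to right by being conjugated: \<open>e h = h (h\<^sup>-\<^sup>1 e h)\<close>.
\<close>

lemma Fil_letter_mult:
  assumes "e \<in> letters" "x \<in> Fil n"
  shows "e * x \<in> Fil (Suc n)"
proof (rule mult_mem_of_span[OF _ _ assms(2)[unfolded Fil_def]])
  fix z assume "z \<in> {h * prod_list es | h es. grouplike h \<and> set es \<subseteq> letters \<and> length es < n}"
  then obtain h es where z: "z = h * prod_list es" "grouplike h" "set es \<subseteq> letters" "length es < n"
    by blast
  have "conj_by h e \<in> letters"
    using assms(1) z(2) conj_skew[of h e] by (auto simp: letters_def intro!: grouplike_mult ginv)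
  then have "h * prod_list (conj_by h e # es) \<in> Fil (Suc n)"
    using z by (intro Fil_base) auto
  then show "e * z \<in> Fil (Suc n)"
    using z(2) by (simp add: z(1) conj_by_def mult.assoc ginv)
qed simp

lemma words_base: "set es \<subseteq> letters \<Longrightarrow> prod_list es \<in> words (length es)"
  unfolding words_def by (rule span_base) blast

lemma words_letter_mult:
  assumes "e \<in> letters" "x \<in> words n"
  shows "e * x \<in> words (Suc n)"
  by (rule mult_mem_of_span[OF _ _ assms(2)[unfolded words_def]])
    (use assms(1) words_base[of "e # _"] in auto)

text \<open>
  Expanding \<open>\<Delta>\<close> of a word letter by letter, the only term in which no letter moves to the second
  tensor factor is the word tensor 1; all the other terms have fewer letters in the first factor.
\<close>

lemma rcontr_word:
  assumes "functional f" "set es \<subseteq> letters"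
  shows "rcontr f (prod_list es) - scale (f 1) (prod_list es) \<in> Fil (length es)"
  using assms
proof (induction es arbitrary: f)
  case Nil
  then show ?case by (simp add: rcontr_one)
next
  case (Cons e es)
  then obtain g where g: "grouplike g" "e \<in> skew_space g" by (auto simp: letters_def)
  let ?x = "prod_list es" and ?f = "\<lambda>z. f (e * z)"
  have f': "functional ?f" by (rule functional_mult_left[OF Cons.prems(1)])
  have "rcontr f (e * ?x) - scale (f 1) (e * ?x) =
      e * (rcontr f ?x - scale (f 1) ?x) + g * (rcontr ?f ?x - scale (?f 1) ?x)
      + scale (f e) (g * ?x)"
    by (simp add: rcontr_skew_mult[OF Cons.prems(1) g(2)] right_diff_distrib scale_mult_right)
  also have "\<dots> \<in> Fil (Suc (length es))"
    using Cons g f' Fil_mono[OF _ Cons.IH[OF f']]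
    by (intro subspace_add subspace_scale Fil_letter_mult Fil_grouplike_mult Fil_base subspace_Fil)
      auto
  finally show ?case by simp
qed

lemma rcontr_words:
  assumes f: "functional f" and x: "x \<in> words n"
  shows "rcontr f x - scale (f 1) x \<in> Fil n"
proof -
  interpret r: Vector_Spaces.linear scale scale "rcontr f" by (rule linear_rcontr[OF f])
  have "Vector_Spaces.linear scale scale (\<lambda>x. rcontr f x - scale (f 1) x)"
    by (simp add: Vector_Spaces.linear_iff vector_space_axioms r.add r.scale algebra_simps
        scale_right_diff_distrib scale_right_distrib)
  then interpret d: Vector_Spaces.linear scale scale "\<lambda>x. rcontr f x - scale (f 1) x" .
  have "words n \<subseteq> {x. rcontr f x - scale (f 1) x \<in> Fil n}"
    unfolding words_def
    by (rule span_minimal[OF _ d.subspace_linear_preimage]) (use rcontr_word[OF f] in auto)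
  with x show ?thesis by auto
qed

lemma linear_image_Fil:
  assumes "Vector_Spaces.linear scale scale L" "subspace N" "x \<in> Fil n"
    and "\<And>h es. grouplike h \<Longrightarrow> set es \<subseteq> letters \<Longrightarrow> length es < n \<Longrightarrow> L (h * prod_list es) \<in> N"
  shows "L x \<in> N"
proof -
  interpret L: Vector_Spaces.linear scale scale L by (rule assms(1))
  have "Fil n \<subseteq> {x. L x \<in> N}"
    unfolding Fil_def
    by (rule span_minimal[OF _ L.subspace_linear_preimage[OF assms(2)]]) (use assms(4) in blast)
  with assms(3) show ?thesis by auto
qed

lemma rcontr_Fil:
  assumes f: "functional f" and x: "x \<in> Fil n"
  shows "rcontr f x \<in> Fil n"
proof (rule linear_image_Fil[OF linear_rcontr[OF f] subspace_Fil x])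
  fix h es assume h: "grouplike h" and es: "set es \<subseteq> letters" "length es < n"
  let ?f = "\<lambda>z. f (h * z)" and ?w = "prod_list es"
  have "rcontr ?f ?w - scale (?f 1) ?w \<in> Fil n"
    using Fil_mono[OF less_imp_le[OF es(2)] rcontr_word[OF functional_mult_left[OF f] es(1)]] .
  moreover have "scale (?f 1) (1 * ?w) \<in> Fil n"
    by (rule subspace_scale[OF subspace_Fil Fil_base[OF grouplike_one es]])
  ultimately have "rcontr ?f ?w \<in> Fil n"
    using subspace_add[OF subspace_Fil] by fastforce
  then show "rcontr f (h * ?w) \<in> Fil n"
    unfolding rcontr_grouplike_mult[OF f h] by (rule Fil_grouplike_mult[OF h])
qed

text \<open>
  The terms that keep all letters in the first factor have a group-like second factor, where \<open>f\<close>
  vanishes.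
\<close>

lemma rcontr_Fil_lower:
  assumes f: "functional f" "\<And>h. grouplike h \<Longrightarrow> f h = 0" and x: "x \<in> Fil n"
  shows "rcontr f x \<in> Fil (n - 1)"
proof (rule linear_image_Fil[OF linear_rcontr[OF f(1)] subspace_Fil x])
  fix h es assume h: "grouplike h" and es: "set es \<subseteq> letters" "length es < n"
  have "rcontr (\<lambda>z. f (h * z)) (prod_list es) \<in> Fil (length es)"
    using rcontr_word[OF functional_mult_left[OF f(1)] es(1), of h] f(2)[OF h] by simp
  moreover have "length es \<le> n - 1" using es(2) by simp
  ultimately have "rcontr (\<lambda>z. f (h * z)) (prod_list es) \<in> Fil (n - 1)"
    using Fil_mono by blast
  then show "rcontr f (h * prod_list es) \<in> Fil (n - 1)"
    unfolding rcontr_grouplike_mult[OF f(1) h] by (rule Fil_grouplike_mult[OF h])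
qed

text \<open>
  Contracting against the functional that is 1 at \<open>h\<^sub>0\<close> and 0 at the other group-like elements keeps
  only the summand of \<open>h\<^sub>0\<close>, up to words with fewer letters.
\<close>

lemma coset_separation:
  assumes S: "finite S" "S \<subseteq> Collect grouplike" and x: "\<And>h. h \<in> S \<Longrightarrow> x h \<in> words n"
    and sum: "(\<Sum>h\<in>S. h * x h) \<in> Fil n" and h0: "h0 \<in> S"
  shows "x h0 \<in> Fil n"
proof -
  obtain f where f: "functional f" "\<And>h. grouplike h \<Longrightarrow> f h = (if h = h0 then 1 else 0)"
    using exists_coefficient_functional[of h0] h0 S by auto
  interpret r: Vector_Spaces.linear scale scale "rcontr f" by (rule linear_rcontr[OF f(1)])
  have "rcontr f (h * x h) - (if h = h0 then h0 * x h0 else 0) \<in> Fil n" if "h \<in> S" for h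
  proof -
    have h: "grouplike h" using that S by auto
    have "h * (rcontr (\<lambda>z. f (h * z)) (x h) - scale (f (h * 1)) (x h)) \<in> Fil n"
      by (intro Fil_grouplike_mult[OF h] rcontr_words functional_mult_left f x that)
    then show ?thesis
      using f(2)[OF h] by (auto simp: rcontr_grouplike_mult[OF f(1) h] right_diff_distrib split: if_splits)
  qed
  then have "(\<Sum>h\<in>S. rcontr f (h * x h) - (if h = h0 then h0 * x h0 else 0)) \<in> Fil n"
    by (intro subspace_sum) auto
  then have "rcontr f (\<Sum>h\<in>S. h * x h) - h0 * x h0 \<in> Fil n"
    using S h0 by (simp add: sum_subtractf r.sum sum.delta)
  then have "h0 * x h0 \<in> Fil n"
    using subspace_diff[OF subspace_Fil rcontr_Fil[OF f(1) sum]] by fastforce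
  moreover have "grouplike h0" using S h0 by auto
  ultimately show ?thesis using Fil_grouplike_mult[OF ginv(1), of h0 "h0 * x h0" n] by (simp add: ginv)
qed

end

section \<open>A twisted derivation on words\<close>

definition qint :: "'k::field \<Rightarrow> nat \<Rightarrow> 'k" where
  "qint q m = (\<Sum>i<m. q ^ i)"

lemma qint_0 [simp]: "qint q 0 = 0" and qint_1 [simp]: "qint q (Suc 0) = 1"
  by (simp_all add: qint_def)

lemma qint_Suc: "qint q (Suc m) = 1 + q * qint q m"
  unfolding qint_def sum.lessThan_Suc_shift by (simp add: sum_distrib_left)

context hopf_algebra
begin

text \<open>
  The words of length \<open>k\<close> that consist of letters \<open>y\<close> and letters from \<open>U\<close>, fewer than \<open>a\<close> of them
  equal to \<open>y\<close>, followed by letters from \<open>L\<close>.  The strict bound makes the case \<open>a = 0\<close> empty.  The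
  set \<open>U\<close> collects what conjugation by the weight of \<open>y\<close> adds to a multiple of \<open>y\<close>.
\<close>

inductive filtered_word :: "'h set \<Rightarrow> 'h \<Rightarrow> 'h set \<Rightarrow> nat \<Rightarrow> nat \<Rightarrow> 'h \<Rightarrow> bool"
  for U y L where
  base: "set es \<subseteq> L \<Longrightarrow> filtered_word U y L (Suc a) (length es) (prod_list es)"
| low: "u \<in> U \<Longrightarrow> filtered_word U y L a k x \<Longrightarrow> filtered_word U y L a (Suc k) (u * x)"
| top: "filtered_word U y L a k x \<Longrightarrow> filtered_word U y L (Suc a) (Suc k) (y * x)"

text \<open>
  Degree less than \<open>a\<close> in \<open>y\<close>, modulo words with fewer than \<open>k\<close> letters.
\<close>

definition ydeg :: "'h set \<Rightarrow> 'h \<Rightarrow> 'h set \<Rightarrow> nat \<Rightarrow> nat \<Rightarrow> 'h set" where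
  "ydeg U y L a k = span (Collect (filtered_word U y L a k) \<union> Fil k)"

text \<open>
  When a letter of weight \<open>g\<close> is deleted from a word, \<open>g\<close> is left in its place; the factor in front
  removes it again, at the cost of conjugating the letters before it.
\<close>

definition dcontr :: "'h \<Rightarrow> ('h \<Rightarrow> 'k) \<Rightarrow> 'h \<Rightarrow> 'h" where
  "dcontr g f x = ginv g * rcontr f x"

lemma subspace_ydeg [simp]: "subspace (ydeg U y L a k)"
  by (simp add: ydeg_def)

lemma filtered_word_0: "\<not> filtered_word U y L 0 k x"
proof
  assume "filtered_word U y L 0 k x"
  then show False by (induction "0 :: nat" k x rule: filtered_word.induct) auto
qed

lemma filtered_word_mono: "filtered_word U y L a k x \<Longrightarrow> a \<le> b \<Longrightarrow> filtered_word U y L b k x"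
proof (induction arbitrary: b rule: filtered_word.induct)
  case (base es a)
  then show ?case using filtered_word.base[of es L U y "b - 1"] by (cases b) auto
next
  case (top a k x)
  then show ?case using filtered_word.top[of U y L "b - 1" k x] by (cases b) auto
qed (auto intro: filtered_word.low)

lemma ydeg_0: "ydeg U y L 0 k = Fil k"
proof -
  have empty: "Collect (filtered_word U y L 0 k) = {}" using filtered_word_0 by auto
  show ?thesis unfolding ydeg_def empty by simp
qed

lemma ydeg_mono: "x \<in> ydeg U y L a k \<Longrightarrow> a \<le> b \<Longrightarrow> x \<in> ydeg U y L b k"
  unfolding ydeg_def by (erule subsetD[OF span_mono, rotated]) (auto intro: filtered_word_mono)

lemma filtered_word_in_ydeg: "filtered_word U y L a k x \<Longrightarrow> x \<in> ydeg U y L a k"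
  unfolding ydeg_def by (rule span_base) simp

lemma Fil_in_ydeg: "x \<in> Fil k \<Longrightarrow> x \<in> ydeg U y L a k"
  unfolding ydeg_def by (rule span_base) simp

text \<open>
  The letter \<open>y\<close> is an eigenvector, modulo \<open>U\<close>, of conjugation by its weight, and \<open>f\<close> recognizes the
  letter \<open>y\<close> among the letters \<open>y\<close>, those in \<open>U\<close> and those in \<open>L\<close>.
\<close>

context
  fixes U L :: "'h set" and y g :: 'h and q :: 'k and f :: "'h \<Rightarrow> 'k"
  assumes g: "grouplike g" and y: "y \<in> skew_space g" and U: "U \<subseteq> skew_space g"
    and L: "L \<subseteq> letters"
    and conj_U: "\<And>u. u \<in> U \<Longrightarrow> conj_by g u \<in> U"
    and conj_y: "conj_by g y - scale q y \<in> U"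
    and f: "functional f" and f_grouplike: "\<And>h. grouplike h \<Longrightarrow> f h = 0"
    and f_L: "\<And>e. e \<in> L \<Longrightarrow> f e = 0" and f_U: "\<And>u. u \<in> U \<Longrightarrow> f u = 0" and f_y: "f y = 1"
begin

lemma y_letter: "y \<in> letters" and U_letters: "u \<in> U \<Longrightarrow> u \<in> letters"
  using g y U by (auto simp: letters_def)

lemma filtered_word_in_words: "filtered_word U y L a k x \<Longrightarrow> x \<in> words k"
  by (induction rule: filtered_word.induct)
    (use L y_letter U_letters words_letter_mult words_base in auto)

lemma ydeg_low_mult:
  assumes "u \<in> U" "x \<in> ydeg U y L a k"
  shows "u * x \<in> ydeg U y L a (Suc k)"
  by (rule mult_mem_of_span[OF _ _ assms(2)[unfolded ydeg_def]])
    (use assms(1) in \<open>auto intro: filtered_word_in_ydeg filtered_word.low Fil_in_ydeg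
      Fil_letter_mult U_letters\<close>)

lemma ydeg_top_mult:
  assumes "x \<in> ydeg U y L a k"
  shows "y * x \<in> ydeg U y L (Suc a) (Suc k)"
  by (rule mult_mem_of_span[OF _ _ assms(1)[unfolded ydeg_def]])
    (auto intro: filtered_word_in_ydeg filtered_word.top Fil_in_ydeg Fil_letter_mult y_letter)

lemma linear_dcontr: "Vector_Spaces.linear scale scale (dcontr g f)"
  by (simp add: Vector_Spaces.linear_iff vector_space_axioms dcontr_def rcontr_add[OF f]
      rcontr_scale[OF f] distrib_left scale_mult_right[symmetric])

lemma dcontr_Fil: "x \<in> Fil k \<Longrightarrow> dcontr g f x \<in> Fil (k - 1)"
  unfolding dcontr_def
  by (rule Fil_grouplike_mult[OF ginv(1)[OF g] rcontr_Fil_lower[OF f f_grouplike]])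

text \<open>
  The twisted Leibniz rule, valid modulo words with fewer letters: either the letter \<open>e\<close> is kept
  and conjugated, or it is the deleted one.
\<close>

lemma dcontr_mult:
  assumes e: "e \<in> skew_space g" and x: "x \<in> words k"
  shows "dcontr g f (e * x) - (conj_by g e * dcontr g f x + scale (f e) x) \<in> Fil k"
proof -
  let ?f = "\<lambda>z. f (e * z)"
  have "dcontr g f (e * x) = conj_by g e * dcontr g f x + rcontr ?f x"
    by (simp add: dcontr_def rcontr_skew_mult[OF f e] conj_by_def distrib_left mult.assoc ginv g)
  moreover have "rcontr ?f x - scale (?f 1) x \<in> Fil k"
    by (rule rcontr_words[OF functional_mult_left[OF f] x])
  ultimately show ?thesis by simp
qed

text \<open>
  No single letter of the word is seen by \<open>f\<close>, so only terms that lose at least two letters remain.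
\<close>

lemma rcontr_base:
  assumes "set es \<subseteq> L"
  shows "rcontr f (prod_list es) \<in> Fil (length es - 1)"
  using assms
proof (induction es)
  case Nil
  then show ?case by (simp add: rcontr_one f f_grouplike)
next
  case (Cons e es)
  let ?f = "\<lambda>z. f (e * z)"
  obtain h where h: "grouplike h" "e \<in> skew_space h" using Cons.prems L by (auto simp: letters_def)
  have es: "set es \<subseteq> letters" using Cons.prems L by auto
  have "rcontr ?f (prod_list es) - scale (?f 1) (prod_list es) \<in> Fil (length es)"
    by (rule rcontr_word[OF functional_mult_left[OF f] es])
  then have 1: "h * rcontr ?f (prod_list es) \<in> Fil (length es)"
    using Cons.prems f_L h by (intro Fil_grouplike_mult) auto
  have 2: "e * rcontr f (prod_list es) \<in> Fil (length es)"
  proof (cases es)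
    case Nil
    then show ?thesis by (simp add: rcontr_one f f_grouplike)
  next
    case (Cons e' es')
    then show ?thesis
      using Fil_letter_mult[of e "rcontr f (prod_list es)" "length es - 1"] Cons.IH Cons.prems L
      by auto
  qed
  show ?case using subspace_add[OF subspace_Fil 2 1] by (simp add: rcontr_skew_mult[OF f h(2)])
qed

lemma dcontr_base: "set es \<subseteq> L \<Longrightarrow> dcontr g f (prod_list es) \<in> Fil (length es - 1)"
  unfolding dcontr_def by (intro Fil_grouplike_mult ginv rcontr_base g)

lemma conj_y_mult: "conj_by g y * x = scale q (y * x) + (conj_by g y - scale q y) * x"
  by (simp add: left_diff_distrib scale_mult_left)

text \<open>
  Exactly one \<open>y\<close> is deleted, and the letters before it are conjugated.  Conjugation preserves \<open>U\<close> and
  turns \<open>y\<close> into a multiple of \<open>y\<close> plus an element of \<open>U\<close>, so it never raises the degree in \<open>y\<close>.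
  The subtraction \<open>k - 1\<close> truncates at the empty word; there the induction step
  uses that the value is zero.
\<close>

lemma dcontr_filtered_word: "filtered_word U y L a k x \<Longrightarrow> dcontr g f x \<in> ydeg U y L (a - 1) (k - 1) \<and> (k = 0 \<longrightarrow> dcontr g f x = 0)"
proof (induction rule: filtered_word.induct)
  case (base es a)
  then show ?case using dcontr_base[of es] by (auto intro: Fil_in_ydeg)
next
  case (low u a k x)
  have "conj_by g u * dcontr g f x \<in> ydeg U y L (a - 1) k"
  proof (cases k)
    case 0
    then show ?thesis using low by (simp add: subspace_0)
  next
    case (Suc k')
    then show ?thesis using low ydeg_low_mult[OF conj_U, of u "dcontr g f x" "a - 1" k'] by simp
  qed
  moreover have "dcontr g f (u * x) - conj_by g u * dcontr g f x \<in> ydeg U y L (a - 1) k"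
    using dcontr_mult[of u x k] filtered_word_in_words[OF low.hyps(2)] low.hyps U f_U
    by (auto intro: Fil_in_ydeg)
  ultimately show ?case using subspace_add[OF subspace_ydeg] by fastforce
next
  case (top a k x)
  let ?u = "conj_by g y - scale q y"
  have "a \<noteq> 0" using top.hyps filtered_word_0 by metis
  have yD: "y * dcontr g f x \<in> ydeg U y L a k" and uD: "?u * dcontr g f x \<in> ydeg U y L a k"
  proof -
    show "y * dcontr g f x \<in> ydeg U y L a k"
    proof (cases k)
      case 0
      then show ?thesis using top by (simp add: subspace_0)
    next
      case (Suc k')
      then show ?thesis using top ydeg_top_mult[of "dcontr g f x" "a - 1" k'] \<open>a \<noteq> 0\<close> by simp
    qed
    have "?u * dcontr g f x \<in> ydeg U y L (a - 1) k"
    proof (cases k)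
      case 0
      then show ?thesis using top by (simp add: subspace_0)
    next
      case (Suc k')
      then show ?thesis using top ydeg_low_mult[OF conj_y, of "dcontr g f x" "a - 1" k'] by simp
    qed
    then show "?u * dcontr g f x \<in> ydeg U y L a k" by (rule ydeg_mono) simp
  qed
  have "conj_by g y * dcontr g f x + scale (f y) x \<in> ydeg U y L a k"
    unfolding conj_y_mult
    using yD uD filtered_word_in_ydeg[OF top.hyps] by (intro subspace_add subspace_scale subspace_ydeg)
  moreover have "dcontr g f (y * x) - (conj_by g y * dcontr g f x + scale (f y) x) \<in> ydeg U y L a k"
    using dcontr_mult[OF y filtered_word_in_words[OF top.hyps]] by (rule Fil_in_ydeg)
  ultimately have "dcontr g f (y * x) \<in> ydeg U y L a k" using subspace_add[OF subspace_ydeg] by fastforce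
  then show ?case by simp
qed

lemma dcontr_ydeg:
  assumes "x \<in> ydeg U y L a k"
  shows "dcontr g f x \<in> ydeg U y L (a - 1) (k - 1)"
proof -
  interpret D: Vector_Spaces.linear scale scale "dcontr g f" by (rule linear_dcontr)
  have "ydeg U y L a k \<subseteq> {x. dcontr g f x \<in> ydeg U y L (a - 1) (k - 1)}"
    unfolding ydeg_def[of _ _ _ a k]
    by (rule span_minimal[OF _ D.subspace_linear_preimage[OF subspace_ydeg]])
      (use dcontr_filtered_word Fil_in_ydeg dcontr_Fil in blast)
  with assms show ?thesis by auto
qed

lemma dcontr_iter_ydeg: "x \<in> ydeg U y L a k \<Longrightarrow> (dcontr g f ^^ m) x \<in> ydeg U y L (a - m) (k - m)"
proof (induction m)
  case (Suc m)
  then show ?case using dcontr_ydeg[of "(dcontr g f ^^ m) x" "a - m" "k - m"] by simp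
qed simp

lemma power_filtered_word:
  assumes "set es \<subseteq> L"
  shows "filtered_word U y L (Suc m) (m + length es) (y ^ m * prod_list es)"
proof (induction m)
  case 0
  then show ?case using filtered_word.base[OF assms, of U y 0] by simp
next
  case (Suc m)
  then show ?case using filtered_word.top[OF Suc] by (simp add: mult.assoc)
qed

text \<open>
  Deleting the letter number \<open>i + 1\<close> conjugates the \<open>i\<close> letters before it and contributes \<open>q\<^sup>i\<close>; the
  conjugates that meet \<open>U\<close> have lower degree in \<open>y\<close>.
\<close>

lemma dcontr_power:
  assumes es: "set es \<subseteq> L"
  shows "dcontr g f (y ^ Suc m * prod_list es) - scale (qint q (Suc m)) (y ^ m * prod_list es)
    \<in> ydeg U y L m (m + length es)"
proof (induction m)
  case 0
  let ?r = "prod_list es"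
  have r: "?r \<in> words (length es)" using es L by (intro words_base) auto
  have "conj_by g y * dcontr g f ?r \<in> Fil (length es)"
  proof (cases "es = []")
    case True
    then show ?thesis by (simp add: dcontr_def rcontr_one f f_grouplike)
  next
    case False
    have "conj_by g y \<in> letters" using conj_skew_self[OF g y] g by (auto simp: letters_def)
    from Fil_letter_mult[OF this dcontr_base[OF es]] show ?thesis using False by simp
  qed
  then have "(dcontr g f (y * ?r) - (conj_by g y * dcontr g f ?r + scale (f y) ?r)) + conj_by g y * dcontr g f ?r \<in> Fil (length es)"
    by (intro subspace_add subspace_Fil dcontr_mult y r)
  then show ?case by (simp add: f_y ydeg_0)
next
  case (Suc m)
  let ?r = "prod_list es" and ?u = "conj_by g y - scale q y" and ?k = "m + length es"
  let ?c = "qint q (Suc m)"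
  define x' where "x' = y ^ m * ?r"
  define x where "x = y * x'"
  have x_eq: "y ^ Suc m * ?r = x" "y ^ Suc (Suc m) * ?r = y * x" by (simp_all add: x_def x'_def mult.assoc)
  define z where "z = dcontr g f x - scale ?c x'"
  have z: "z \<in> ydeg U y L m ?k" using Suc.IH unfolding x_eq by (simp add: z_def x'_def)
  have Dx: "dcontr g f x = scale ?c x' + z" by (simp add: z_def)
  have x: "x \<in> words (Suc ?k)"
    using filtered_word_in_words[OF power_filtered_word[OF es, of "Suc m"]] unfolding x_eq by simp
  have 1: "dcontr g f (y * x) - (conj_by g y * dcontr g f x + scale (f y) x) \<in> ydeg U y L (Suc m) (Suc ?k)"
    by (rule Fil_in_ydeg[OF dcontr_mult[OF y x]])
  have 2: "scale q (y * z) \<in> ydeg U y L (Suc m) (Suc ?k)"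
    by (intro subspace_scale subspace_ydeg ydeg_top_mult z)
  have 3: "?u * dcontr g f x \<in> ydeg U y L (Suc m) (Suc ?k)"
    unfolding Dx
    by (intro ydeg_low_mult conj_y subspace_add subspace_scale subspace_ydeg
        filtered_word_in_ydeg[OF power_filtered_word[OF es, of m, folded x'_def]] ydeg_mono[OF z]) simp
  have "dcontr g f (y * x) - scale (qint q (Suc (Suc m))) x =
      (dcontr g f (y * x) - (conj_by g y * dcontr g f x + scale (f y) x)) + scale q (y * z) + ?u * dcontr g f x"
    unfolding conj_y_mult[of "dcontr g f x"]
    by (simp add: Dx f_y qint_Suc[of q "Suc m"] scale_left_distrib distrib_left scale_right_distrib
        scale_mult_right[symmetric] flip: x_def)
  also have "\<dots> \<in> ydeg U y L (Suc m) (Suc ?k)"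
    by (intro subspace_add subspace_ydeg 1 2 3)
  finally show ?case unfolding x_eq by simp
qed

lemma linear_dcontr_iter: "Vector_Spaces.linear scale scale (dcontr g f ^^ m)"
proof (induction m)
  case 0
  then show ?case by (simp add: Vector_Spaces.linear_iff vector_space_axioms)
next
  case (Suc m)
  then show ?case using Vector_Spaces.linear_compose[OF Suc linear_dcontr] by (simp only: funpow.simps)
qed

text \<open>
  Iterating the previous lemma multiplies the \<open>q\<close>-integers to a \<open>q\<close>-factorial; the errors of lower
  degree in \<open>y\<close> run out of letters \<open>y\<close> and fall into the filtration.
\<close>

lemma dcontr_iter_power:
  assumes es: "set es \<subseteq> L"
  shows "(dcontr g f ^^ m) (y ^ m * prod_list es) - scale (\<Prod>i=1..m. qint q i) (prod_list es)
    \<in> Fil (length es)"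
proof (induction m)
  case 0
  then show ?case by (simp add: subspace_0)
next
  case (Suc m)
  interpret Dm: Vector_Spaces.linear scale scale "dcontr g f ^^ m" by (rule linear_dcontr_iter)
  let ?r = "prod_list es" and ?c = "qint q (Suc m)"
  define z where "z = dcontr g f (y ^ Suc m * ?r) - scale ?c (y ^ m * ?r)"
  have z: "(dcontr g f ^^ m) z \<in> Fil (length es)"
    using dcontr_iter_ydeg[OF dcontr_power[OF es, of m], of m] by (simp add: z_def ydeg_0)
  have "(dcontr g f ^^ Suc m) (y ^ Suc m * ?r) = (dcontr g f ^^ m) (scale ?c (y ^ m * ?r) + z)"
    by (simp only: funpow_Suc_right o_apply z_def) simp
  also have "\<dots> = scale ?c ((dcontr g f ^^ m) (y ^ m * ?r)) + (dcontr g f ^^ m) z"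
    by (simp add: Dm.add Dm.scale)
  finally have "(dcontr g f ^^ Suc m) (y ^ Suc m * ?r) - scale (\<Prod>i=1..Suc m. qint q i) ?r =
      scale ?c ((dcontr g f ^^ m) (y ^ m * ?r) - scale (\<Prod>i=1..m. qint q i) ?r) + (dcontr g f ^^ m) z"
    by (simp add: scale_right_diff_distrib mult.commute)
  also have "\<dots> \<in> Fil (length es)"
    by (intro subspace_add subspace_scale subspace_Fil z Suc.IH)
  finally show ?case .
qed

end


end

section \<open>Linear independence of ordered monomials\<close>

context hopf_algebra
begin

text \<open>
  Lists of letters for which ordered monomials are independent over the group-like elements.  The
  set \<open>X\<close> contains \<open>C0\<close> and the letters; it may be larger than their span, which makes room for
  letters whose conjugates are not spanned by the list.  In the step, \<open>X \<inter> skew_space g\<close> takes the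
  part of the error space \<open>U\<close> above, and a functional vanishing on \<open>X\<close> recognizes \<open>y\<close>.
\<close>

inductive admissible :: "'h list \<Rightarrow> 'h set \<Rightarrow> bool" where
  Nil: "subspace X \<Longrightarrow> C0 \<subseteq> X \<Longrightarrow> admissible [] X"
| Cons: "admissible ys X \<Longrightarrow> grouplike g \<Longrightarrow> y \<in> skew_space g \<Longrightarrow> y \<notin> X \<Longrightarrow>
    (\<And>x. x \<in> X \<Longrightarrow> x \<in> skew_space g \<Longrightarrow> conj_by g x \<in> X) \<Longrightarrow>
    conj_by g y - scale q y \<in> X \<Longrightarrow> (\<And>m. 0 < m \<Longrightarrow> qint q m \<noteq> 0) \<Longrightarrow>
    admissible (y # ys) (span (insert y X))"

lemma admissible_facts:
  "admissible ys X \<Longrightarrow> subspace X \<and> C0 \<subseteq> X \<and> set ys \<subseteq> X \<and> set ys \<subseteq> letters"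
proof (induction rule: admissible.induct)
  case (Cons ys X g y q)
  have "insert y X \<subseteq> span (insert y X)" by (rule span_superset)
  then show ?case using Cons by (auto simp: letters_def)
qed auto

fun monomial :: "'h list \<Rightarrow> nat list \<Rightarrow> 'h" where
  "monomial (y # ys) (n # ns) = y ^ n * monomial ys ns"
| "monomial _ _ = 1"

lemma monomial_word:
  "length ns = length ys \<Longrightarrow>
    \<exists>es. set es \<subseteq> set ys \<and> length es = sum_list ns \<and> monomial ys ns = prod_list es"
proof (induction ys arbitrary: ns)
  case (Cons y ys)
  then obtain n ns' where ns: "ns = n # ns'" by (cases ns) auto
  then obtain es where es: "set es \<subseteq> set ys" "length es = sum_list ns'" "monomial ys ns' = prod_list es"
    using Cons by auto
  have "prod_list (replicate n y) = y ^ n" by (induction n) auto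
  then show ?case
    using ns es by (intro exI[of _ "replicate n y @ es"]) auto
qed (auto intro: exI[of _ "[]"])

text \<open>
  Among the monomials with a nonzero coefficient, take those with the highest exponent \<open>m\<close> of the first
  letter.  Deleting this letter \<open>m\<close> times annihilates the other monomials modulo the filtration and
  leaves a relation between monomials in the remaining letters, whose coefficients are multiplied by
  a nonzero \<open>q\<close>-factorial.
\<close>

lemma monomials_independent_mod_Fil:
  assumes "admissible ys X" "finite I" "\<And>ns. ns \<in> I \<Longrightarrow> length ns = length ys \<and> sum_list ns = N"
    and "(\<Sum>ns\<in>I. scale (c ns) (monomial ys ns)) \<in> Fil N" "ns \<in> I"
  shows "c ns = 0"
  using assms
proof (induction arbitrary: I N c ns rule: admissible.induct)
  case (Nil X)
  then have "I = {[]}" "N = 0" "ns = []" by fastforce+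
  then show ?case using Nil.prems by simp
next
  case (Cons ys X g y q)
  show ?case
  proof (rule ccontr)
    assume "c ns \<noteq> 0"
    define I' where "I' = {ns \<in> I. c ns \<noteq> 0}"
    define m where "m = Max (hd ` I')"
    define I'' where "I'' = {ns \<in> I'. hd ns = m}"
    have I': "finite I'" "I' \<noteq> {}" using Cons.prems \<open>c ns \<noteq> 0\<close> by (auto simp: I'_def)
    then have "m \<in> hd ` I'" unfolding m_def by (intro Max_in) auto
    then obtain ns0 where ns0: "ns0 \<in> I''" by (auto simp: I''_def)
    have X: "subspace X" "C0 \<subseteq> X" "set ys \<subseteq> X" "set ys \<subseteq> letters"
      using admissible_facts[OF Cons.hyps(1)] by auto
    obtain f where f: "functional f" "\<And>x. x \<in> X \<Longrightarrow> f x = 0" "f y = 1"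
      using exists_functional_separating[OF X(1) \<open>y \<notin> X\<close>] by auto
    let ?U = "X \<inter> skew_space g" and ?D = "dcontr g f"
    have "conj_by g y - scale q y \<in> skew_space g"
      by (intro subspace_diff subspace_scale subspace_skew_space conj_skew_self Cons.hyps)
    then have ctx: "grouplike g" "y \<in> skew_space g" "?U \<subseteq> skew_space g" "set ys \<subseteq> letters"
      "\<And>u. u \<in> ?U \<Longrightarrow> conj_by g u \<in> ?U" "conj_by g y - scale q y \<in> ?U" "functional f"
      "\<And>h. grouplike h \<Longrightarrow> f h = 0" "\<And>e. e \<in> set ys \<Longrightarrow> f e = 0" "\<And>u. u \<in> ?U \<Longrightarrow> f u = 0"
      "f y = 1"
      using Cons.hyps X f conj_skew_self span_superset[of "Collect grouplike"] by (auto simp: C0_def)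
    interpret Dm: Vector_Spaces.linear scale scale "?D ^^ m"
      by (rule linear_dcontr_iter[OF ctx])
    let ?C = "\<Prod>i=1..m. qint q i"
    \<comment> \<open>the image of a monomial under the iterated operator, up to the filtration\<close>
    let ?lead = "\<lambda>ns. if hd ns = m then scale ?C (monomial ys (tl ns)) else 0"
    have lead: "(?D ^^ m) (monomial (y # ys) ns) - ?lead ns \<in> Fil (N - m)" if ns: "ns \<in> I'" for ns
    proof -
      have "length ns = Suc (length ys)" "sum_list ns = N"
        using ns Cons.prems(2) by (auto simp: I'_def)
      then obtain a ms where ams: "ns = a # ms" "length ms = length ys" "a + sum_list ms = N"
        by (cases ns) auto
      have "a \<le> m" unfolding m_def using I' ns ams by (intro Max_ge) (auto intro!: image_eqI[of _ _ ns])
      obtain es where es: "set es \<subseteq> set ys" "length es = sum_list ms" "monomial ys ms = prod_list es"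
        using monomial_word[OF ams(2)] by auto
      show ?thesis
      proof (cases "a = m")
        case True
        then show ?thesis using dcontr_iter_power[OF ctx es(1), of m] ams es by auto
      next
        case False
        have "y ^ a * prod_list es \<in> ydeg ?U y (set ys) (Suc a) N"
          using filtered_word_in_ydeg[OF power_filtered_word[OF ctx es(1), of a]] ams es by simp
        from dcontr_iter_ydeg[OF ctx this, of m]
        have "(?D ^^ m) (y ^ a * prod_list es) \<in> Fil (N - m)"
          using False \<open>a \<le> m\<close> by (simp add: ydeg_0)
        then show ?thesis using False ams es by simp
      qed
    qed
    have "(\<Sum>ns\<in>I'. scale (c ns) (monomial (y # ys) ns)) =
        (\<Sum>ns\<in>I. scale (c ns) (monomial (y # ys) ns))"
      using Cons.prems(1) by (intro sum.mono_neutral_left) (auto simp: I'_def)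
    then have "(\<Sum>ns\<in>I'. scale (c ns) (monomial (y # ys) ns)) \<in> ydeg ?U y (set ys) 0 N"
      using Cons.prems(3) by (simp add: ydeg_0)
    from dcontr_iter_ydeg[OF ctx this, of m]
    have "(\<Sum>ns\<in>I'. scale (c ns) ((?D ^^ m) (monomial (y # ys) ns))) \<in> Fil (N - m)"
      by (simp add: ydeg_0 Dm.sum Dm.scale)
    moreover have "(\<Sum>ns\<in>I'. scale (c ns) ((?D ^^ m) (monomial (y # ys) ns) - ?lead ns)) \<in> Fil (N - m)"
      using lead by (intro subspace_sum subspace_scale subspace_Fil)
    ultimately have "(\<Sum>ns\<in>I'. scale (c ns) (?lead ns)) \<in> Fil (N - m)"
      using subspace_diff[OF subspace_Fil] by (fastforce simp: scale_right_diff_distrib sum_subtractf)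
    also have "(\<Sum>ns\<in>I'. scale (c ns) (?lead ns)) =
        (\<Sum>ns\<in>I''. scale (c ns * ?C) (monomial ys (tl ns)))"
      using I'(1) by (intro sum.mono_neutral_cong_right) (auto simp: I''_def)
    also have "\<dots> = (\<Sum>ms\<in>tl ` I''. scale (c (m # ms) * ?C) (monomial ys ms))"
    proof (rule sum.reindex_cong[symmetric, of tl])
      have "ns = m # tl ns" if "ns \<in> I''" for ns
        using that Cons.prems(2)[of ns] by (cases ns) (auto simp: I''_def I'_def)
      then show "inj_on tl I''" "\<And>ns. ns \<in> I'' \<Longrightarrow>
          scale (c (m # tl ns) * ?C) (monomial ys (tl ns)) = scale (c ns * ?C) (monomial ys (tl ns))"
        by (metis inj_onI, metis)
    qed simp
    finally have "(\<Sum>ms\<in>tl ` I''. scale (c (m # ms) * ?C) (monomial ys ms)) \<in> Fil (N - m)" .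
    moreover have "finite (tl ` I'')" using I' by (simp add: I''_def)
    moreover have "length ms = length ys \<and> sum_list ms = N - m" if ms: "ms \<in> tl ` I''" for ms
    proof -
      obtain ns where "ms = tl ns" "ns \<in> I''" using ms by auto
      then show ?thesis using Cons.prems(2)[of ns] by (cases ns) (auto simp: I''_def I'_def)
    qed
    ultimately have "c (m # tl ns0) * ?C = 0"
      using Cons.IH[of "tl ` I''" "N - m" "\<lambda>ms. c (m # ms) * ?C" "tl ns0"] ns0 by auto
    moreover have "?C \<noteq> 0" using Cons.hyps by auto
    moreover have "ns0 = m # tl ns0"
      using ns0 Cons.prems(2)[of ns0] by (cases ns0) (auto simp: I''_def I'_def)
    ultimately show False using ns0 by (auto simp: I''_def I'_def)
  qed
qed

text \<open>
  In a relation, the monomials of the highest total degree form a relation modulo words with fewer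
  letters; it splits into one relation for each group-like factor.
\<close>

lemma coset_monomials_independent:
  assumes adm: "admissible ys X" and I: "finite I"
    "\<And>h ns. (h, ns) \<in> I \<Longrightarrow> grouplike h \<and> length ns = length ys"
    and sum0: "(\<Sum>(h, ns)\<in>I. scale (c (h, ns)) (h * monomial ys ns)) = 0" and p: "p \<in> I"
  shows "c p = 0"
proof (rule ccontr)
  assume "c p \<noteq> 0"
  define I' where "I' = {p \<in> I. c p \<noteq> 0}"
  define N where "N = Max ((\<lambda>(h, ns). sum_list ns) ` I')"
  define T where "T = {p \<in> I'. sum_list (snd p) = N}"
  let ?t = "\<lambda>(h, ns). scale (c (h, ns)) (h * monomial ys ns)"
  have "p \<in> I'" using p \<open>c p \<noteq> 0\<close> by (simp add: I'_def)
  then have I': "finite I'" "I' \<noteq> {}" using I(1) by (simp add: I'_def, blast)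
  then have "N \<in> (\<lambda>(h, ns). sum_list ns) ` I'" unfolding N_def by (intro Max_in) auto
  then obtain h0 ns0 where p0: "(h0, ns0) \<in> T" by (auto simp: T_def)
  have ys: "set ys \<subseteq> letters" using admissible_facts[OF adm] by auto
  have "(\<Sum>p\<in>I'. ?t p) = (\<Sum>p\<in>I. ?t p)"
    using I(1) by (intro sum.mono_neutral_left) (auto simp: I'_def)
  then have "(\<Sum>p\<in>I' - T. ?t p) + (\<Sum>p\<in>T. ?t p) = 0"
    using sum.subset_diff[of T I' ?t] I' sum0 by (auto simp: T_def)
  then have "(\<Sum>p\<in>T. ?t p) = - (\<Sum>p\<in>I' - T. ?t p)" by (simp add: eq_neg_iff_add_eq_0 add.commute)
  also have "\<dots> \<in> Fil N"
  proof (intro subspace_neg subspace_sum subspace_Fil)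
    fix p assume p: "p \<in> I' - T"
    obtain h ns where hn: "p = (h, ns)" by force
    have hns: "grouplike h" "length ns = length ys" using I(2)[of h ns] p hn by (auto simp: I'_def)
    have "sum_list ns \<le> N" unfolding N_def using I' p hn by (intro Max_ge) auto
    then have "sum_list ns < N" using p hn by (auto simp: T_def)
    moreover obtain es where "set es \<subseteq> set ys" "length es = sum_list ns" "monomial ys ns = prod_list es"
      using monomial_word[OF hns(2)] by auto
    ultimately show "?t p \<in> Fil N"
      using hns ys hn Fil_base[of h es N] by (auto intro!: subspace_scale)
  qed
  finally have sumT: "(\<Sum>p\<in>T. ?t p) \<in> Fil N" .
  define K where "K h = {ns. (h, ns) \<in> T}" for h
  define x where "x h = (\<Sum>ns\<in>K h. scale (c (h, ns)) (monomial ys ns))" for h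
  have T: "finite T" "T = Sigma (fst ` T) K" using I' by (force simp: T_def K_def)+
  have finK: "finite (K h)" for h
    using finite_vimageI[OF T(1), of "Pair h"] by (auto simp: K_def vimage_def inj_on_def)
  have K: "grouplike h \<and> length ns = length ys \<and> sum_list ns = N" if "ns \<in> K h" for h ns
    using that I(2)[of h ns] by (auto simp: K_def T_def I'_def)
  have "(\<Sum>p\<in>T. ?t p) = (\<Sum>h\<in>fst ` T. \<Sum>ns\<in>K h. scale (c (h, ns)) (h * monomial ys ns))"
    using sum.Sigma[of "fst ` T" K "\<lambda>h ns. scale (c (h, ns)) (h * monomial ys ns)"] T finK by auto
  also have "\<dots> = (\<Sum>h\<in>fst ` T. h * x h)"
    by (simp add: x_def sum_distrib_left scale_mult_right)
  finally have "(\<Sum>h\<in>fst ` T. h * x h) \<in> Fil N" using sumT by simp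
  moreover have "x h \<in> words N" for h
    unfolding x_def
  proof (intro subspace_sum subspace_scale subspace_words)
    fix ns assume "ns \<in> K h"
    then show "monomial ys ns \<in> words N"
      using monomial_word[of ns ys] words_base K[of ns h] ys by fastforce
  qed
  moreover have "fst ` T \<subseteq> Collect grouplike" using K by (force simp: K_def)
  ultimately have "x h0 \<in> Fil N"
    using coset_separation[of "fst ` T" x N h0] T(1) p0 by force
  then have "c (h0, ns0) = 0"
    unfolding x_def
    using monomials_independent_mod_Fil[OF adm finK, of h0 N "\<lambda>ns. c (h0, ns)" ns0] K p0
    by (auto simp: K_def)
  then show False using p0 by (auto simp: T_def I'_def)
qed

end

section \<open>Dimension of a quotient space\<close>

context assoc_algebra
begin

lemma span_finite_support:
  assumes "x \<in> span S"
  shows "\<exists>T. finite T \<and> T \<subseteq> S \<and> x \<in> span T"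
  using assms
proof (induction rule: span_induct_alt)
  case base
  then show ?case by (intro exI[of _ "{}"]) simp
next
  case (step c x y)
  then obtain T where T: "finite T" "T \<subseteq> S" "y \<in> span T" by blast
  have "scale c x + y \<in> span (insert x T)"
  proof (rule span_add)
    show "scale c x \<in> span (insert x T)" by (intro span_scale span_base) simp
    show "y \<in> span (insert x T)" using T(3) span_mono[of T "insert x T"] by blast
  qed
  then show ?case using T step.hyps by (intro exI[of _ "insert x T"] conjI) simp_all
qed

text \<open>
  The usual exchange argument, after replacing \<open>U\<close> by a finite independent subset of \<open>U\<close> that still
  expresses \<open>B\<close>: adding it to both sides turns independence modulo \<open>U\<close> into independence.
\<close>

lemma card_le_of_independent_mod:
  assumes U: "subspace U" and B: "finite B" "B \<subseteq> span (U \<union> S)" and S: "finite S"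
    and indep: "\<And>F f. finite F \<Longrightarrow> F \<subseteq> B \<Longrightarrow> (\<Sum>b\<in>F. scale (f b) b) \<in> U \<Longrightarrow> \<forall>b\<in>F. f b = 0"
  shows "card B \<le> card S"
proof -
  have "\<forall>b\<in>B. \<exists>T. finite T \<and> T \<subseteq> U \<union> S \<and> b \<in> span T"
    using span_finite_support B(2) by blast
  from bchoice[OF this] obtain T
    where T: "\<And>b. b \<in> B \<Longrightarrow> finite (T b) \<and> T b \<subseteq> U \<union> S \<and> b \<in> span (T b)"
    by blast
  define V where "V = span (\<Union>(T ` B) \<inter> U)"
  have VU: "V \<subseteq> U" unfolding V_def using U by (intro span_minimal) auto
  obtain A where A: "A \<subseteq> \<Union>(T ` B) \<inter> U" "independent A" "\<Union>(T ` B) \<inter> U \<subseteq> span A"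
    using maximal_independent_subset by blast
  have finA: "finite A" using A(1) B(1) T by (auto intro: finite_subset)
  have "T b \<subseteq> span (A \<union> S)" if "b \<in> B" for b
  proof
    fix t assume "t \<in> T b"
    then have "t \<in> span A \<or> t \<in> S" using T[OF that] A(3) that by auto
    then show "t \<in> span (A \<union> S)"
      using span_mono[of A "A \<union> S"] span_base[of t "A \<union> S"] by auto
  qed
  then have "span (T b) \<subseteq> span (A \<union> S)" if "b \<in> B" for b
    using that by (intro span_minimal subspace_span)
  then have "B \<subseteq> span (A \<union> S)" using T by auto
  then have sub: "B \<union> A \<subseteq> span (A \<union> S)" using span_superset[of "A \<union> S"] by auto
  have disj: "B \<inter> A = {}"
  proof (rule ccontr)
    assume "B \<inter> A \<noteq> {}"
    then obtain b where b: "b \<in> B" "b \<in> U" using A(1) by auto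
    then show False using indep[of "{b}" "\<lambda>_. 1"] by simp
  qed
  have "independent (B \<union> A)"
  proof
    assume "dependent (B \<union> A)"
    then obtain u where u: "\<exists>v\<in>B \<union> A. u v \<noteq> 0" "(\<Sum>v\<in>B \<union> A. scale (u v) v) = 0"
      using dependent_finite[of "B \<union> A"] B(1) finA by auto
    then have s: "(\<Sum>v\<in>B. scale (u v) v) + (\<Sum>v\<in>A. scale (u v) v) = 0"
      using B(1) finA disj by (simp add: sum.union_disjoint)
    then have "(\<Sum>v\<in>B. scale (u v) v) = - (\<Sum>v\<in>A. scale (u v) v)"
      by (simp add: eq_neg_iff_add_eq_0)
    also have "\<dots> \<in> U" using A(1) by (intro subspace_neg subspace_sum subspace_scale U) auto
    finally have "\<forall>b\<in>B. u b = 0" by (intro indep B) auto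
    moreover from this s have "\<forall>a\<in>A. u a = 0"
      using independentD[OF A(2) finA subset_refl, of u] by simp
    ultimately show False using u(1) by auto
  qed
  then have "card (B \<union> A) \<le> card (A \<union> S)"
    using independent_span_bound[of "A \<union> S" "B \<union> A"] finA S sub by auto
  also have "\<dots> \<le> card A + card S" by (rule card_Un_le)
  finally show ?thesis using B(1) finA disj by (simp add: card_Un_disjoint)
qed

text \<open>
  A subset of \<open>S\<close> of least cardinality that still generates \<open>Z\<close> modulo \<open>U\<close> is a basis of the quotient,
  and every other basis has at most as many elements.
\<close>

lemma quotient_dim_le_card:
  assumes U: "subspace U" and S: "finite S" "S \<subseteq> Z" "Z \<subseteq> span (U \<union> S)"
  shows "quotient_dim Z U \<le> ereal (real (card S))"
proof -
  define good where "good T \<longleftrightarrow> T \<subseteq> S \<and> Z \<subseteq> span (U \<union> T)" for T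
  obtain T where T: "good T" "\<And>T'. good T' \<Longrightarrow> card T \<le> card T'"
    using ex_has_least_nat[of good S card] S by (auto simp: good_def)
  have finT: "finite T" using T(1) S(1) by (auto simp: good_def intro: finite_subset)
  have "quotient_basis Z U T"
    unfolding quotient_basis_def
  proof (intro conjI allI impI ballI)
    show "T \<subseteq> Z" "Z \<subseteq> span (T \<union> U)" using T(1) S(2) by (auto simp: good_def Un_commute)
    fix F f b assume F: "finite F \<and> F \<subseteq> T \<and> (\<Sum>b\<in>F. scale (f b) b) \<in> U" and b: "b \<in> F"
    show "f b = 0"
    proof (rule ccontr)
      assume fb: "f b \<noteq> 0"
      let ?s = "\<Sum>x\<in>F - {b}. scale (f x) x" and ?R = "span (U \<union> (T - {b}))"
      have "(\<Sum>b\<in>F. scale (f b) b) = scale (f b) b + ?s" using F b by (simp add: sum.remove)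
      moreover have "(\<Sum>b\<in>F. scale (f b) b) \<in> ?R" using F by (intro span_base) simp
      moreover have "?s \<in> ?R" using F by (intro span_sum span_scale span_base) blast
      ultimately have "scale (f b) b \<in> ?R" using span_diff by fastforce
      then have "scale (inverse (f b)) (scale (f b) b) \<in> ?R" by (rule span_scale)
      then have bR: "b \<in> ?R" using fb by simp
      have "U \<union> T \<subseteq> ?R" using bR span_superset[of "U \<union> (T - {b})"] by auto
      then have "span (U \<union> T) \<subseteq> ?R" by (rule span_minimal[OF _ subspace_span])
      then have "Z \<subseteq> ?R" using T(1) unfolding good_def by blast
      then have "good (T - {b})" using T(1) by (auto simp: good_def)
      from T(2)[OF this] show False
        using card_Diff1_less[OF finT, of b] F b by auto
    qed
  qed
  then have ex: "\<exists>B. finite B \<and> quotient_basis Z U B" using finT by blast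
  define B where "B = (SOME B. finite B \<and> quotient_basis Z U B)"
  have B: "finite B" "quotient_basis Z U B" using someI_ex[OF ex] by (auto simp: B_def)
  then have "card B \<le> card S"
    by (intro card_le_of_independent_mod[OF U _ _ S(1)]) (use S(3) in \<open>auto simp: quotient_basis_def\<close>)
  then show ?thesis unfolding quotient_dim_def using ex by (simp add: B_def)
qed

lemma span_insert_span: "span (insert y (span S)) = span (insert y S)"
proof (rule antisym)
  show "span (insert y (span S)) \<subseteq> span (insert y S)"
    using span_mono[of S "insert y S"] by (intro span_minimal) (auto intro: span_base)
  show "span (insert y S) \<subseteq> span (insert y (span S))"
    by (rule span_mono) (use span_superset in auto)
qed

end

section \<open>Conjugation on skew primitive elements\<close>

context hopf_algebra
begin

lemma subspace_C0 [simp]: "subspace C0"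
  by (simp add: C0_def)

lemma grouplike_C0: "grouplike g \<Longrightarrow> g \<in> C0"
  by (simp add: C0_def span_base)

lemma conj_by_C0:
  assumes "grouplike g" "x \<in> C0"
  shows "conj_by g x \<in> C0"
proof -
  interpret T: Vector_Spaces.linear scale scale "conj_by g" by (rule linear_conj_by)
  have "C0 \<subseteq> {x. conj_by g x \<in> C0}"
    unfolding C0_def
    by (rule span_minimal[OF _ T.subspace_linear_preimage[OF subspace_span]])
      (use assms in \<open>auto simp: conj_by_def intro!: span_base grouplike_mult ginv\<close>)
  then show ?thesis using assms by auto
qed

lemma conj_minus_eq: "conj_minus g c x = conj_by g x - scale c x"
  by (simp add: conj_minus_def conj_by_def)

lemma linear_conj_minus: "Vector_Spaces.linear scale scale (conj_minus g c)"
proof -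
  interpret T: Vector_Spaces.linear scale scale "conj_by g" by (rule linear_conj_by)
  show ?thesis
    by (simp add: Vector_Spaces.linear_iff vector_space_axioms conj_minus_eq T.add T.scale
        scale_right_distrib scale_right_diff_distrib mult.commute)
qed

lemma conj_minus_commute: "conj_minus g c (conj_minus g d x) = conj_minus g d (conj_minus g c x)"
proof -
  interpret T: Vector_Spaces.linear scale scale "conj_by g" by (rule linear_conj_by)
  show ?thesis by (simp add: conj_minus_eq T.diff T.scale scale_right_diff_distrib mult.commute)
qed

lemma conj_minus_C0: "grouplike g \<Longrightarrow> x \<in> C0 \<Longrightarrow> conj_minus g c x \<in> C0"
  unfolding conj_minus_eq by (intro subspace_diff subspace_scale conj_by_C0 subspace_C0)

lemma conj_minus_skew: "grouplike g \<Longrightarrow> x \<in> skew_space g \<Longrightarrow> conj_minus g c x \<in> skew_space g"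
  unfolding conj_minus_eq by (intro subspace_diff subspace_scale conj_skew_self subspace_skew_space)

lemma conj_minus_iter_skew:
  "grouplike g \<Longrightarrow> x \<in> skew_space g \<Longrightarrow> (conj_minus g c ^^ n) x \<in> skew_space g"
  by (induction n) (auto intro: conj_minus_skew)

lemma conj_minus_iter_C0:
  assumes "grouplike g" "(conj_minus g c ^^ n) x \<in> C0" "n \<le> m"
  shows "(conj_minus g c ^^ m) x \<in> C0"
  using assms(3)
  by (induction m rule: dec_induct) (auto intro: assms conj_minus_C0)

text \<open>
  The generalized eigenspace of conjugation by \<open>g\<close> on the skew primitive elements of weight \<open>g\<close>,
  computed modulo \<open>C0\<close>.
\<close>

definition gen_eigenspace :: "'h \<Rightarrow> 'k \<Rightarrow> 'h set" where
  "gen_eigenspace g c = {y \<in> skew_space g. \<exists>n. (conj_minus g c ^^ n) y \<in> C0}"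

lemma linear_conj_minus_iter: "Vector_Spaces.linear scale scale (conj_minus g c ^^ n)"
proof (induction n)
  case 0
  then show ?case by (simp add: Vector_Spaces.linear_iff vector_space_axioms)
next
  case (Suc n)
  then show ?case
    using Vector_Spaces.linear_compose[OF Suc linear_conj_minus] by (simp only: funpow.simps)
qed

lemma subspace_gen_eigenspace:
  assumes g: "grouplike g"
  shows "subspace (gen_eigenspace g c)"
proof (rule subspaceI)
  show "0 \<in> gen_eigenspace g c"
    using subspace_0[OF subspace_skew_space] subspace_0[OF subspace_C0]
    by (auto simp: gen_eigenspace_def intro!: exI[of _ 0])
next
  fix a x assume "x \<in> gen_eigenspace g c"
  then obtain n where n: "x \<in> skew_space g" "(conj_minus g c ^^ n) x \<in> C0"
    by (auto simp: gen_eigenspace_def)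
  interpret T: Vector_Spaces.linear scale scale "conj_minus g c ^^ n" by (rule linear_conj_minus_iter)
  show "scale a x \<in> gen_eigenspace g c"
    using n by (auto simp: gen_eigenspace_def T.scale intro!: exI[of _ n] subspace_scale subspace_skew_space)
next
  fix x y assume "x \<in> gen_eigenspace g c" "y \<in> gen_eigenspace g c"
  then obtain m n where mn: "x \<in> skew_space g" "(conj_minus g c ^^ m) x \<in> C0"
    "y \<in> skew_space g" "(conj_minus g c ^^ n) y \<in> C0"
    by (auto simp: gen_eigenspace_def)
  let ?k = "max m n"
  interpret T: Vector_Spaces.linear scale scale "conj_minus g c ^^ ?k" by (rule linear_conj_minus_iter)
  have "(conj_minus g c ^^ ?k) (x + y) \<in> C0"
    unfolding T.add
    by (intro subspace_add subspace_C0 conj_minus_iter_C0[OF g mn(2)] conj_minus_iter_C0[OF g mn(4)]) auto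
  then show "x + y \<in> gen_eigenspace g c"
    using mn by (auto simp: gen_eigenspace_def intro!: subspace_add subspace_skew_space)
qed

lemma gen_eigenspace_C0: "x \<in> skew_space g \<Longrightarrow> x \<in> C0 \<Longrightarrow> x \<in> gen_eigenspace g c"
  by (auto simp: gen_eigenspace_def intro!: exI[of _ 0])

lemma conj_minus_gen_eigenspace:
  assumes "grouplike g" "x \<in> gen_eigenspace g c"
  shows "conj_minus g d x \<in> gen_eigenspace g c"
proof -
  have "(conj_minus g c ^^ n) (conj_minus g d x) = conj_minus g d ((conj_minus g c ^^ n) x)" for n
    by (induction n) (simp_all add: conj_minus_commute)
  then show ?thesis
    using assms conj_minus_skew conj_minus_C0 by (fastforce simp: gen_eigenspace_def)
qed

text \<open>
  On the generalized eigenspace of \<open>d\<close>, the operator \<open>T - c\<close> is the scalar \<open>d - c\<close> plus the operator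
  \<open>T - d\<close>, which is nilpotent modulo \<open>C0\<close>.
\<close>

lemma conj_minus_surj_gen_eigenspace:
  assumes g: "grouplike g" and cd: "c \<noteq> d" and "x \<in> gen_eigenspace g d"
  shows "\<exists>x' \<in> gen_eigenspace g d. conj_minus g c x' - x \<in> C0"
proof -
  have "\<exists>x' \<in> gen_eigenspace g d. conj_minus g c x' - x \<in> C0"
    if "x \<in> skew_space g" "(conj_minus g d ^^ n) x \<in> C0" for n x
    using that
  proof (induction n arbitrary: x)
    case 0
    interpret T: Vector_Spaces.linear scale scale "conj_minus g c" by (rule linear_conj_minus)
    show ?case
      using 0 subspace_0[OF subspace_gen_eigenspace[OF g]] subspace_neg[OF subspace_C0]
      by (intro bexI[of _ 0]) (auto simp: T.zero)
  next
    case (Suc n)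
    interpret T: Vector_Spaces.linear scale scale "conj_minus g c" by (rule linear_conj_minus)
    \<comment> \<open>solve \<open>(T - c) x' = x\<close> by \<open>(x - z) / (d - c)\<close>, where \<open>z\<close> corrects the error \<open>(T - d) x\<close>\<close>
    let ?w = "conj_minus g d x" and ?a = "inverse (d - c)"
    have "?w \<in> skew_space g" "(conj_minus g d ^^ n) ?w \<in> C0"
      using Suc.prems conj_minus_skew[OF g] by (auto simp: funpow_swap1)
    then obtain z where z: "z \<in> gen_eigenspace g d" "conj_minus g c z - ?w \<in> C0"
      using Suc.IH by blast
    have x: "x \<in> gen_eigenspace g d" using Suc.prems by (auto simp: gen_eigenspace_def simp del: funpow.simps)
    have "conj_minus g c x = scale (d - c) x + ?w"
      by (simp add: conj_minus_eq scale_left_diff_distrib)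
    then have "conj_minus g c (scale ?a (x - z)) - x = scale ?a (?w - conj_minus g c z)"
      using cd by (simp add: T.scale T.diff scale_right_distrib scale_right_diff_distrib)
    also have "\<dots> = scale (- ?a) (conj_minus g c z - ?w)"
      by (simp add: scale_right_diff_distrib)
    also have "\<dots> \<in> C0" by (intro subspace_scale subspace_C0 z)
    finally show ?case
      using x z by (intro bexI[of _ "scale ?a (x - z)"])
        (auto intro!: subspace_scale subspace_diff subspace_gen_eigenspace g)
  qed
  then show ?thesis using assms(3) by (auto simp: gen_eigenspace_def)
qed

lemma span_gen_eigenspaces_skew:
  "span (\<Union>c. gen_eigenspace g c) \<subseteq> skew_space g"
  by (rule span_minimal[OF _ subspace_skew_space]) (auto simp: gen_eigenspace_def)

text \<open>
  Every vector of the span is \<open>T - c\<close> of another vector of the span, up to the generalized eigenspace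
  of \<open>c\<close>: the other generalized eigenspaces are covered by surjectivity, and vectors of this one are
  congruent to zero.  Hence \<open>w\<close> differs from a vector of the span by an element that \<open>T - c\<close> maps to
  the generalized eigenspace of \<open>c\<close>, which therefore is itself in it.
\<close>

lemma span_gen_eigenspaces_conj_minus:
  assumes g: "grouplike g" and w: "w \<in> skew_space g"
    and "conj_minus g c w \<in> span (\<Union>c. gen_eigenspace g c)"
  shows "w \<in> span (\<Union>c. gen_eigenspace g c)"
proof -
  interpret T: Vector_Spaces.linear scale scale "conj_minus g c" by (rule linear_conj_minus)
  let ?S = "span (\<Union>c. gen_eigenspace g c)"
  have E: "subspace (gen_eigenspace g c)" by (rule subspace_gen_eigenspace[OF g])
  have "\<exists>z'\<in>?S. conj_minus g c z' - z \<in> gen_eigenspace g c" if "z \<in> ?S" for z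
    using that
  proof (induction rule: span_induct_alt)
    case base
    then show ?case using subspace_0[OF E] by (intro bexI[of _ 0]) (auto simp: T.zero span_zero)
  next
    case (step a x y)
    then obtain y' where y': "y' \<in> ?S" "conj_minus g c y' - y \<in> gen_eigenspace g c" by blast
    obtain d where d: "x \<in> gen_eigenspace g d" using step by auto
    have "\<exists>x'\<in>?S. conj_minus g c x' - x \<in> gen_eigenspace g c"
    proof (cases "d = c")
      case True
      then show ?thesis using subspace_neg[OF E] d by (intro bexI[of _ 0]) (auto simp: T.zero span_zero)
    next
      case False
      then obtain x' where x': "x' \<in> gen_eigenspace g d" "conj_minus g c x' - x \<in> C0"
        using conj_minus_surj_gen_eigenspace[OF g _ d, of c] by auto
      then have "conj_minus g c x' - x \<in> skew_space g"
        using d g by (auto simp: gen_eigenspace_def intro!: subspace_diff subspace_skew_space conj_minus_skew)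
      then show ?thesis using x' by (intro bexI[of _ x'] gen_eigenspace_C0) (auto intro!: span_base)
    qed
    then obtain x' where x': "x' \<in> ?S" "conj_minus g c x' - x \<in> gen_eigenspace g c" by blast
    have "conj_minus g c (scale a x' + y') - (scale a x + y) =
        scale a (conj_minus g c x' - x) + (conj_minus g c y' - y)"
      by (simp add: T.add T.scale scale_right_diff_distrib)
    also have "\<dots> \<in> gen_eigenspace g c" by (intro subspace_add subspace_scale E x' y')
    finally show ?case using x' y' by (intro bexI[of _ "scale a x' + y'"]) (auto intro!: span_add span_scale)
  qed
  from this[OF assms(3)] obtain z' where z': "z' \<in> ?S" "conj_minus g c (z' - w) \<in> gen_eigenspace g c"
    by (auto simp: T.diff)
  then obtain n where n: "(conj_minus g c ^^ Suc n) (z' - w) \<in> C0"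
    by (auto simp: gen_eigenspace_def funpow_swap1)
  have "z' - w \<in> skew_space g"
    using z' w span_gen_eigenspaces_skew by (intro subspace_diff subspace_skew_space) auto
  then have "z' - w \<in> gen_eigenspace g c" using n unfolding gen_eigenspace_def by blast
  then have "z' - w \<in> ?S" by (intro span_base) auto
  from span_diff[OF z'(1) this] show ?thesis by simp
qed

text \<open>
  The polynomial \<open>p\<close> evaluated at conjugation by \<open>g\<close>, applied to \<open>x\<close>.
\<close>

definition poly_act :: "'h \<Rightarrow> 'k poly \<Rightarrow> 'h \<Rightarrow> 'h" where
  "poly_act g p x = (\<Sum>i\<le>degree p. scale (coeff p i) ((conj_by g ^^ i) x))"

lemma poly_act_eq:
  "degree p \<le> n \<Longrightarrow> poly_act g p x = (\<Sum>i\<le>n. scale (coeff p i) ((conj_by g ^^ i) x))"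
  unfolding poly_act_def by (intro sum.mono_neutral_left) (auto simp: coeff_eq_0)

lemma poly_act_add: "poly_act g (p + q) x = poly_act g p x + poly_act g q x"
proof -
  let ?n = "max (degree p) (degree q)"
  have "degree (p + q) \<le> ?n" by (rule degree_add_le_max)
  then show ?thesis
    by (simp add: poly_act_eq[of _ ?n] scale_left_distrib sum.distrib)
qed

lemma poly_act_smult: "poly_act g (smult c p) x = scale c (poly_act g p x)"
  by (simp add: poly_act_eq[OF degree_smult_le] poly_act_def scale_sum_right)

lemma poly_act_diff: "poly_act g (p - q) x = poly_act g p x - poly_act g q x"
  using poly_act_add[of g "p - q" q x] by (simp add: algebra_simps)

lemma poly_act_pCons_0: "poly_act g (pCons 0 p) x = poly_act g p (conj_by g x)"
proof -
  have "degree (pCons 0 p) \<le> Suc (degree p)" by (simp add: degree_pCons_le)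
  then show ?thesis
    by (simp add: poly_act_eq poly_act_def[of _ p] sum.atMost_Suc_shift funpow_swap1 del: sum.atMost_Suc)
qed

lemma linear_conj_by_iter: "Vector_Spaces.linear scale scale (conj_by g ^^ n)"
proof (induction n)
  case 0
  then show ?case by (simp add: Vector_Spaces.linear_iff vector_space_axioms)
next
  case (Suc n)
  then show ?case
    using Vector_Spaces.linear_compose[OF Suc linear_conj_by] by (simp only: funpow.simps)
qed

lemma poly_act_linear_factor:
  "poly_act g ([:- c, 1:] * p) x = poly_act g p (conj_minus g c x)"
proof -
  have T: "(conj_by g ^^ n) (conj_by g x - scale c x) =
      (conj_by g ^^ n) (conj_by g x) - scale c ((conj_by g ^^ n) x)" for n
  proof -
    interpret T: Vector_Spaces.linear scale scale "conj_by g ^^ n" by (rule linear_conj_by_iter)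
    show ?thesis by (simp add: T.diff T.scale)
  qed
  have "poly_act g ([:- c, 1:] * p) x = poly_act g p (conj_by g x) - scale c (poly_act g p x)"
    by (simp add: poly_act_add poly_act_diff poly_act_smult poly_act_pCons_0)
  also have "\<dots> = poly_act g p (conj_minus g c x)"
    by (simp add: poly_act_def conj_minus_eq T scale_right_diff_distrib sum_subtractf scale_sum_right
        mult.commute)
  finally show ?thesis .
qed

lemma poly_act_monom: "poly_act g (monom 1 n) x = (conj_by g ^^ n) x"
  by (simp add: poly_act_eq[OF degree_monom_le] if_distrib[of "\<lambda>a. scale a _"] sum.delta cong: if_cong)

text \<open>
  Induction on the number of linear factors: stripping off one of them replaces \<open>x\<close> by its image under
  \<open>T - a\<close>.
\<close>

lemma gen_eigenspaces_of_split_poly: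
  assumes g: "grouplike g"
  shows "x \<in> skew_space g \<Longrightarrow> poly_act g (\<Prod>a\<in>#A. [:- a, 1:]) x \<in> C0 \<Longrightarrow>
    x \<in> span (\<Union>c. gen_eigenspace g c)"
proof (induction A arbitrary: x)
  case empty
  then have "x \<in> C0" by (simp add: poly_act_def)
  then show ?case using gen_eigenspace_C0[OF empty(1)] by (intro span_base) auto
next
  case (add a A)
  then have "conj_minus g a x \<in> span (\<Union>c. gen_eigenspace g c)"
    using conj_minus_skew[OF g] by (simp only: image_mset_add_mset prod_mset.add_mset poly_act_linear_factor)
  then show ?case by (rule span_gen_eigenspaces_conj_minus[OF g add.prems(1)])
qed

text \<open>
  The relation expresses \<open>T\<^sup>i x\<close> by higher powers, so the polynomial has the coefficient 1 at \<open>i\<close>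
  and is nonzero.
\<close>

lemma conj_orbit_relation:
  assumes "(conj_by g ^^ i) x \<in> span (C0 \<union> {(conj_by g ^^ l) x | l. i < l})"
  shows "\<exists>p. p \<noteq> 0 \<and> poly_act g p x \<in> C0"
proof -
  have "\<exists>p. coeff p i = 0 \<and> z - poly_act g p x \<in> C0"
    if "z \<in> span (C0 \<union> {(conj_by g ^^ l) x | l. i < l})" for z
    using that
  proof (induction rule: span_induct_alt)
    case base
    then show ?case using subspace_0[OF subspace_C0] by (intro exI[of _ 0]) (simp add: poly_act_def)
  next
    case (step c z w)
    then obtain p where p: "coeff p i = 0" "w - poly_act g p x \<in> C0" by auto
    have "\<exists>q. coeff q i = 0 \<and> z - poly_act g q x \<in> C0"
    proof (cases "z \<in> C0")
      case True
      then show ?thesis by (intro exI[of _ 0]) (simp add: poly_act_def)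
    next
      case False
      then obtain l where "z = (conj_by g ^^ l) x" "i < l" using step by auto
      then show ?thesis using subspace_0[OF subspace_C0]
        by (intro exI[of _ "monom 1 l"]) (simp add: poly_act_monom)
    qed
    then obtain q where q: "coeff q i = 0" "z - poly_act g q x \<in> C0" by blast
    have "scale c z + w - poly_act g (smult c q + p) x =
        scale c (z - poly_act g q x) + (w - poly_act g p x)"
      by (simp add: poly_act_add poly_act_smult scale_right_diff_distrib)
    also have "\<dots> \<in> C0" by (intro subspace_add subspace_scale subspace_C0 p q)
    finally show ?case using p q by (intro exI[of _ "smult c q + p"]) simp
  qed
  from this[OF assms] obtain p where p: "coeff p i = 0" "(conj_by g ^^ i) x - poly_act g p x \<in> C0"
    by blast
  \<comment> \<open>the polynomial \<open>p\<close> involves only powers greater than \<open>i\<close>\<close>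
  have "coeff (monom 1 i - p) i \<noteq> 0" using p(1) by simp
  then have "monom 1 i - p \<noteq> 0" by (metis coeff_0)
  then show ?thesis using p(2) by (intro exI[of _ "monom 1 i - p"]) (simp add: poly_act_diff poly_act_monom)
qed

text \<open>
  Conjugation sends each letter to the next member of the orbit, which is in the space spanned by
  \<open>C0\<close> and the later members; so the eigenvalue is 0, all of whose \<open>q\<close>-integers are 1.
\<close>

lemma admissible_of_free_orbit:
  assumes g: "grouplike g" and y: "y \<in> skew_space g"
    and free: "\<And>i. (conj_by g ^^ i) y \<notin> span (C0 \<union> {(conj_by g ^^ l) y | l. i < l})"
  shows "\<exists>ys. length ys = d \<and> admissible ys (span (C0 \<union> {(conj_by g ^^ l) y | l. i \<le> l}))"
proof (induction d arbitrary: i)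
  case 0
  have "C0 \<subseteq> span (C0 \<union> {(conj_by g ^^ l) y | l. i \<le> l})"
    using span_superset[of "C0 \<union> {(conj_by g ^^ l) y | l. i \<le> l}"] by blast
  then show ?case by (intro exI[of _ "[]"]) (simp add: admissible.Nil)
next
  case (Suc d)
  let ?X = "\<lambda>i. span (C0 \<union> {(conj_by g ^^ l) y | l. i \<le> l})" and ?y = "(conj_by g ^^ i) y"
  obtain ys where ys: "length ys = d" "admissible ys (?X (Suc i))" using Suc by blast
  interpret T: Vector_Spaces.linear scale scale "conj_by g" by (rule linear_conj_by)
  have skew: "(conj_by g ^^ n) y \<in> skew_space g" for n
    by (induction n) (auto intro: y conj_skew_self[OF g])
  have stable: "conj_by g x \<in> ?X (Suc i)" if "x \<in> ?X (Suc i)" for x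
  proof -
    have "?X (Suc i) \<subseteq> {x. conj_by g x \<in> ?X (Suc i)}"
    proof (rule span_minimal[OF _ T.subspace_linear_preimage[OF subspace_span]], safe)
      fix x assume "x \<in> C0"
      then show "conj_by g x \<in> ?X (Suc i)" by (intro span_base UnI1 conj_by_C0 g)
    next
      fix l assume "Suc i \<le> l"
      then have "conj_by g ((conj_by g ^^ l) y) \<in> {(conj_by g ^^ l) y | l. Suc i \<le> l}"
        by (intro CollectI exI[of _ "Suc l"]) simp
      then show "conj_by g ((conj_by g ^^ l) y) \<in> ?X (Suc i)" by (intro span_base UnI2)
    qed
    then show ?thesis using that by auto
  qed
  have "conj_by g ?y \<in> {(conj_by g ^^ l) y | l. Suc i \<le> l}"
    by (intro CollectI exI[of _ "Suc i"]) simp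
  then have "conj_by g ?y - scale 0 ?y \<in> ?X (Suc i)" by (auto intro: span_base)
  moreover have "qint (0 :: 'k) m \<noteq> 0" if "0 < m" for m
    using that by (cases m) (simp_all add: qint_Suc)
  moreover have "?y \<notin> ?X (Suc i)" using free[of i] by (simp only: Suc_le_eq not_False_eq_True)
  ultimately have "admissible (?y # ys) (span (insert ?y (?X (Suc i))))"
    by (intro admissible.Cons[OF ys(2) g skew _ stable])
  moreover have "insert ?y (C0 \<union> {(conj_by g ^^ l) y | l. Suc i \<le> l}) =
      C0 \<union> {(conj_by g ^^ l) y | l. i \<le> l}"
  proof -
    have orbit: "{(conj_by g ^^ l) y | l. n \<le> l} = (\<lambda>l. (conj_by g ^^ l) y) ` {n..}" for n
      by auto
    have "{i..} = insert i {Suc i..}" by auto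
    then show ?thesis unfolding orbit by simp
  qed
  ultimately show ?case
    using ys(1) unfolding span_insert_span by (intro exI[of _ "?y # ys"]) simp
qed

end

section \<open>Choosing the skew primitive letters\<close>

context hopf_algebra
begin

text \<open>
  Contracting from the left against the functional that is 1 at \<open>g\<close> and 0 at the other group-like
  elements projects, up to scalars, a sum of skew primitive elements to its part of weight \<open>g\<close>.  Stated
  with this projection instead of the elements of weight \<open>g\<close> of \<open>X\<close>, stability under conjugation is a
  linear condition, which can be checked on generators of \<open>X\<close>.
\<close>

definition weight_stable :: "'h set \<Rightarrow> bool" where
  "weight_stable X \<longleftrightarrow> (\<forall>g f x. grouplike g \<longrightarrow> functional f \<longrightarrow>
     (\<forall>h. grouplike h \<longrightarrow> f h = (if h = g then 1 else 0)) \<longrightarrow> x \<in> X \<longrightarrow> conj_by g (lcontr f x) \<in> X)"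

lemma conj_by_one: "grouplike g \<Longrightarrow> conj_by g 1 = 1"
  by (simp add: conj_by_def ginv)

text \<open>
  The projection of \<open>y\<close> is a scalar plus \<open>y\<close> if \<open>y\<close> has weight \<open>g\<close>, and just a scalar otherwise.
\<close>

lemma weight_projection_skew:
  assumes g: "grouplike g" and f: "functional f" "\<forall>h. grouplike h \<longrightarrow> f h = (if h = g then 1 else 0)"
    and y: "grouplike h" "y \<in> skew_space h" "conj_by h y \<in> X" and X: "subspace X" "C0 \<subseteq> X"
  shows "conj_by g (lcontr f y) \<in> X"
proof -
  interpret T: Vector_Spaces.linear scale scale "conj_by g" by (rule linear_conj_by)
  have "conj_by g (lcontr f y) = scale (f y) 1 + scale (f h) (conj_by g y)"
    by (simp add: lcontr_skew[OF f(1) y(2)] T.add T.scale conj_by_one g)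
  moreover have "scale (f y) 1 \<in> X"
    using X grouplike_C0[OF grouplike_one] by (auto intro: subspace_scale)
  moreover have "scale (f h) (conj_by g y) \<in> X"
    using f(2) y X(1) by (cases "h = g") (auto simp: subspace_0)
  ultimately show ?thesis using subspace_add[OF X(1)] by simp
qed

lemma linear_weight_projection:
  "functional f \<Longrightarrow> Vector_Spaces.linear scale scale (\<lambda>x. conj_by g (lcontr f x))"
  using Vector_Spaces.linear_compose[OF linear_lcontr linear_conj_by] by (simp add: o_def)

lemma weight_stable_C0: "weight_stable C0"
  unfolding weight_stable_def
proof (intro allI impI)
  fix g f x
  assume g: "grouplike g" and f: "functional f" "\<forall>h. grouplike h \<longrightarrow> f h = (if h = g then 1 else 0)"
    and x: "x \<in> C0"
  interpret T: Vector_Spaces.linear scale scale "conj_by g" by (rule linear_conj_by)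
  interpret Tl: Vector_Spaces.linear scale scale "\<lambda>x. conj_by g (lcontr f x)"
    by (rule linear_weight_projection[OF f(1)])
  have "C0 \<subseteq> {x. conj_by g (lcontr f x) \<in> C0}"
    unfolding C0_def
  proof (rule span_minimal[OF _ Tl.subspace_linear_preimage[OF subspace_span]], safe)
    fix h assume "grouplike h"
    then have "conj_by g (lcontr f h) = scale (f h) (conj_by g h)" "conj_by g h \<in> C0"
      by (simp_all add: lcontr_grouplike f(1) T.scale conj_by_C0 grouplike_C0 g)
    then show "conj_by g (lcontr f h) \<in> span (Collect grouplike)"
      by (simp add: span_scale flip: C0_def) (simp add: C0_def span_scale)
  qed
  with x show "conj_by g (lcontr f x) \<in> C0" by auto
qed

lemma weight_stable_span_Un:
  assumes X: "weight_stable X" "C0 \<subseteq> X"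
    and S: "\<And>y. y \<in> S \<Longrightarrow> \<exists>g. grouplike g \<and> y \<in> skew_space g \<and> conj_by g y \<in> span (X \<union> S)"
  shows "weight_stable (span (X \<union> S))"
  unfolding weight_stable_def
proof (intro allI impI)
  fix g f x
  assume g: "grouplike g" and f: "functional f" "\<forall>h. grouplike h \<longrightarrow> f h = (if h = g then 1 else 0)"
    and x: "x \<in> span (X \<union> S)"
  interpret Tl: Vector_Spaces.linear scale scale "\<lambda>x. conj_by g (lcontr f x)"
    by (rule linear_weight_projection[OF f(1)])
  have X': "X \<subseteq> span (X \<union> S)" using span_superset[of "X \<union> S"] by auto
  have "X \<union> S \<subseteq> {x. conj_by g (lcontr f x) \<in> span (X \<union> S)}"
  proof safe
    fix z assume "z \<in> X"
    then show "conj_by g (lcontr f z) \<in> span (X \<union> S)"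
      using X(1) g f X' unfolding weight_stable_def by blast
  next
    fix z assume "z \<in> S"
    then show "conj_by g (lcontr f z) \<in> span (X \<union> S)"
      using S weight_projection_skew[OF g f _ _ _ subspace_span] X(2) X' by blast
  qed
  then have "span (X \<union> S) \<subseteq> {x. conj_by g (lcontr f x) \<in> span (X \<union> S)}"
    by (rule span_minimal[OF _ Tl.subspace_linear_preimage[OF subspace_span]])
  then show "conj_by g (lcontr f x) \<in> span (X \<union> S)" using x by auto
qed

lemma weight_stable_conj:
  assumes "weight_stable X" "subspace X" "C0 \<subseteq> X" and g: "grouplike g" and x: "x \<in> X" "x \<in> skew_space g"
  shows "conj_by g x \<in> X"
proof -
  interpret T: Vector_Spaces.linear scale scale "conj_by g" by (rule linear_conj_by)
  obtain f where f: "functional f" "\<forall>h. grouplike h \<longrightarrow> f h = (if h = g then 1 else 0)"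
    using exists_coefficient_functional[OF g] by blast
  have "conj_by g (lcontr f x) \<in> X" using assms f unfolding weight_stable_def by blast
  moreover have "conj_by g (lcontr f x) = scale (f x) 1 + conj_by g x"
    using f(2) g by (simp add: lcontr_skew[OF f(1) x(2)] T.add T.scale conj_by_one)
  moreover have "scale (f x) 1 \<in> X"
    using assms(2,3) grouplike_C0[OF grouplike_one] by (auto intro: subspace_scale)
  ultimately show ?thesis using subspace_diff[OF assms(2)] by fastforce
qed

text \<open>
  The least power of \<open>T - c\<close> that maps \<open>y\<close> to \<open>C0\<close> is the level of the commutator \<open>c\<close>.
\<close>

lemma gen_eigenspace_root_of_unity:
  assumes g: "grouplike g" and c: "root_of_unity c" "c \<noteq> 1" and y: "y \<in> gen_eigenspace g c"
  shows "y \<in> span (C0 \<union> Y_sqrt)"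
proof (cases "y \<in> C0")
  case True
  then show ?thesis by (simp add: span_base)
next
  case False
  obtain n where n: "(conj_minus g c ^^ n) y \<in> C0" using y by (auto simp: gen_eigenspace_def)
  define m where "m = (LEAST n. (conj_minus g c ^^ n) y \<in> C0)"
  have "c \<noteq> 0" using c by (auto simp: root_of_unity_def power_0_left)
  then have "commutator_of_level g y c m"
    unfolding commutator_of_level_def m_def using n by (auto intro: LeastI dest: not_less_Least)
  moreover have "y \<noteq> 0" using False subspace_0[OF subspace_C0] by auto
  ultimately have "y \<in> Y_sqrt"
    unfolding Y_sqrt_def using False y c g
    by (intro span_base) (auto simp: skew_primitive_iff has_commutator_def gen_eigenspace_def)
  then show ?thesis by (simp add: span_base)
qed

text \<open>
  Conjugates of the generators of \<open>Y_sqrt\<close> may fall into \<open>C0\<close>, where they are no generators any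
  more; the generalized eigenspaces, which span the same space together with \<open>C0\<close>, are preserved.
\<close>

lemma weight_stable_C0_Y_sqrt: "weight_stable (span (C0 \<union> Y_sqrt))"
proof -
  define R where "R = {y. \<exists>g c. grouplike g \<and> root_of_unity c \<and> c \<noteq> 1 \<and> y \<in> gen_eigenspace g c}"
  have "Y_sqrt \<subseteq> span (C0 \<union> R)"
    unfolding Y_sqrt_def
    by (rule span_minimal) (fastforce simp: R_def skew_primitive_iff has_commutator_def
        commutator_of_level_def gen_eigenspace_def intro!: span_base)+
  then have "span (C0 \<union> Y_sqrt) \<subseteq> span (C0 \<union> R)"
    using span_superset[of "C0 \<union> R"] by (intro span_minimal) auto
  moreover have "span (C0 \<union> R) \<subseteq> span (C0 \<union> Y_sqrt)"
    using gen_eigenspace_root_of_unity span_superset[of "C0 \<union> Y_sqrt"]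
    by (intro span_minimal) (auto simp: R_def)
  ultimately have eq: "span (C0 \<union> Y_sqrt) = span (C0 \<union> R)" by auto
  show ?thesis
    unfolding eq
  proof (rule weight_stable_span_Un[OF weight_stable_C0 subset_refl])
    fix y assume "y \<in> R"
    then obtain g c where gc: "grouplike g" "root_of_unity c" "c \<noteq> 1" "y \<in> gen_eigenspace g c"
      by (auto simp: R_def)
    have "conj_by g y \<in> gen_eigenspace g c"
      using conj_minus_gen_eigenspace[OF gc(1) gc(4), of 0] by (simp add: conj_minus_eq)
    then have "conj_by g y \<in> R" unfolding R_def using gc by blast
    then show "\<exists>g. grouplike g \<and> y \<in> skew_space g \<and> conj_by g y \<in> span (C0 \<union> R)"
      using gc by (intro exI[of _ g] conjI span_base UnI2) (auto simp: gen_eigenspace_def)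
  qed
qed

end

locale hopf_algebra_acf0 = hopf_algebra scale comult counit antipode
  for scale :: "'k::{alg_closed_field, field_char_0} \<Rightarrow> 'h::ring_1 \<Rightarrow> 'h"
    and comult :: "'h \<Rightarrow> ('h \<times> 'h \<Rightarrow>\<^sub>0 'k)" and counit antipode
begin

lemma qint_nonzero:
  assumes "c = 1 \<or> \<not> root_of_unity c" "0 < m"
  shows "qint c m \<noteq> 0"
proof (cases "c = 1")
  case True
  then show ?thesis using assms(2) by (simp add: qint_def)
next
  case False
  then have "c ^ m - 1 \<noteq> 0" using assms unfolding root_of_unity_def by (metis right_minus_eq)
  then show ?thesis by (auto simp: power_diff_1_eq qint_def)
qed

lemma skew_space_gen_eigenspaces:
  assumes g: "grouplike g" and y: "y \<in> skew_space g" and p: "p \<noteq> 0" "poly_act g p y \<in> C0"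
  shows "y \<in> span (\<Union>c. gen_eigenspace g c)"
proof -
  obtain A where A: "p = smult (lead_coeff p) (\<Prod>a\<in>#A. [:- a, 1:])"
    using alg_closed_imp_factorization[OF p(1)] by blast
  let ?P = "\<Prod>a\<in>#A. [:- a, 1:]"
  have "scale (lead_coeff p) (poly_act g ?P y) \<in> C0"
    using p(2) by (subst (asm) A) (simp add: poly_act_smult)
  then have "scale (inverse (lead_coeff p)) (scale (lead_coeff p) (poly_act g ?P y)) \<in> C0"
    by (rule subspace_scale[OF subspace_C0])
  then have "poly_act g ?P y \<in> C0" using p(1) by simp
  then show ?thesis by (rule gen_eigenspaces_of_split_poly[OF g y])
qed

text \<open>
  Since \<open>X\<close> does not contain \<open>Z\<close>, it misses a generalized eigenvector \<open>z\<close>, whose eigenvalue \<open>c\<close> is 1 or not a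
  root of unity because the others lie in \<open>C0 + Y_sqrt\<close>.  The images of \<open>z\<close> under powers of \<open>T - c\<close>
  eventually enter \<open>X\<close>, and the last one outside is an eigenvector modulo \<open>X\<close>.
\<close>

lemma admissible_extend:
  assumes X: "subspace X" "C0 \<subseteq> X" "Y_sqrt \<subseteq> X" "weight_stable X" "\<not> Z \<subseteq> X"
    and split: "\<And>g y. grouplike g \<Longrightarrow> y \<in> skew_space g \<Longrightarrow> y \<in> span (\<Union>c. gen_eigenspace g c)"
    and adm: "admissible ys X"
  shows "\<exists>g y. grouplike g \<and> y \<in> skew_space g \<and> y \<in> Z \<and> weight_stable (span (insert y X))
    \<and> admissible (y # ys) (span (insert y X))"
proof -
  have one: "1 \<in> X" using X(2) grouplike_C0[OF grouplike_one] by auto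
  have "\<not> insert 1 {y. \<exists>g. skew_primitive g y} \<subseteq> X"
    using X(1,5) span_minimal unfolding Z_def by blast
  then obtain g x where gx: "grouplike g" "x \<in> skew_space g" "x \<notin> X"
    using one by (auto simp: skew_primitive_iff)
  have "\<not> (\<Union>c. gen_eigenspace g c) \<subseteq> X"
    using split[OF gx(1,2)] span_minimal[OF _ X(1)] gx(3) by blast
  then obtain c z where z: "z \<in> gen_eigenspace g c" "z \<notin> X" by auto
  have c: "c = 1 \<or> \<not> root_of_unity c"
  proof (rule ccontr)
    assume "\<not> ?thesis"
    then have "z \<in> span (C0 \<union> Y_sqrt)" using gen_eigenspace_root_of_unity[OF gx(1)] z(1) by auto
    moreover have "span (C0 \<union> Y_sqrt) \<subseteq> X" using X by (intro span_minimal) auto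
    ultimately show False using z(2) by auto
  qed
  obtain n where n: "(conj_minus g c ^^ n) z \<in> X" using z(1) X(2) by (auto simp: gen_eigenspace_def)
  define m where "m = (LEAST n. (conj_minus g c ^^ n) z \<in> X)"
  have m: "(conj_minus g c ^^ m) z \<in> X" unfolding m_def by (rule LeastI[of _ n]) (rule n)
  have "m \<noteq> 0"
  proof
    assume "m = 0"
    then show False using m z(2) by simp
  qed
  then obtain k where k: "m = Suc k" by (cases m) auto
  define y where "y = (conj_minus g c ^^ k) z"
  have y: "y \<notin> X" unfolding y_def using not_less_Least[of k "\<lambda>n. (conj_minus g c ^^ n) z \<in> X"] k
    by (simp add: m_def)
  have cy: "conj_by g y - scale c y \<in> X" using m unfolding k y_def by (simp add: conj_minus_eq)
  have skew: "y \<in> skew_space g"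
    unfolding y_def using z(1) by (auto simp: gen_eigenspace_def intro!: conj_minus_iter_skew gx)
  have "y \<noteq> 0" using y subspace_0[OF X(1)] by auto
  then have "y \<in> Z" unfolding Z_def using skew gx by (intro span_base) (auto simp: skew_primitive_iff)
  moreover have "weight_stable (span (insert y X))"
  proof -
    have "(conj_by g y - scale c y) + scale c y \<in> span (insert y X)"
      using cy by (intro span_add span_scale span_base) auto
    then show ?thesis
      using weight_stable_span_Un[OF X(4,2), of "{y}"] gx(1) skew by auto
  qed
  moreover have "admissible (y # ys) (span (insert y X))"
    by (rule admissible.Cons[OF adm gx(1) skew y _ cy qint_nonzero[OF c]])
      (use weight_stable_conj[OF X(4,1,2) gx(1)] in auto)
  ultimately show ?thesis using gx skew by blast
qed

text \<open>
  Either some orbit under conjugation is free modulo \<open>C0\<close>, or letters can be added one after the other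
  until they generate \<open>Z\<close> modulo \<open>C0 + Y_sqrt\<close>.
\<close>

lemma exists_admissible:
  assumes d: "ereal (real d) \<le> quotient_dim Z (span (C0 \<union> Y_sqrt))"
  shows "\<exists>ys X. length ys = d \<and> admissible ys X"
proof (cases "\<exists>g y. grouplike g \<and> y \<in> skew_space g \<and>
    (\<forall>i. (conj_by g ^^ i) y \<notin> span (C0 \<union> {(conj_by g ^^ l) y | l. i < l}))")
  case True
  then show ?thesis using admissible_of_free_orbit by blast
next
  case False
  let ?Q = "span (C0 \<union> Y_sqrt)"
  have split: "y \<in> span (\<Union>c. gen_eigenspace g c)" if "grouplike g" "y \<in> skew_space g" for g y
    using False that conj_orbit_relation skew_space_gen_eigenspaces by meson
  have "\<exists>ys. length ys = k \<and> set ys \<subseteq> Z \<and> admissible ys (span (?Q \<union> set ys)) \<and>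
      weight_stable (span (?Q \<union> set ys))" if "k \<le> d" for k
    using that
  proof (induction k)
    case 0
    have "C0 \<subseteq> ?Q" using span_superset[of "C0 \<union> Y_sqrt"] by auto
    then show ?case
      using weight_stable_C0_Y_sqrt by (intro exI[of _ "[]"]) (simp add: admissible.Nil span_span)
  next
    case (Suc k)
    then obtain ys where ys: "length ys = k" "set ys \<subseteq> Z" "admissible ys (span (?Q \<union> set ys))"
      "weight_stable (span (?Q \<union> set ys))"
      by auto
    let ?X = "span (?Q \<union> set ys)"
    have QX: "C0 \<subseteq> ?X" "Y_sqrt \<subseteq> ?X"
      using span_superset[of "C0 \<union> Y_sqrt"] span_superset[of "?Q \<union> set ys"] by auto
    have nZ: "\<not> Z \<subseteq> ?X"
    proof
      assume "Z \<subseteq> ?X"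
      then have "ereal (real d) \<le> ereal (real (card (set ys)))"
        using ys(2) by (intro order_trans[OF d quotient_dim_le_card] subspace_span) auto
      then show False using card_length[of ys] ys(1) Suc.prems by simp
    qed
    obtain y where "y \<in> Z" "weight_stable (span (insert y ?X))" "admissible (y # ys) (span (insert y ?X))"
      using admissible_extend[OF subspace_span QX ys(4) nZ split ys(3)] by blast
    then show ?case
      using ys by (intro exI[of _ "y # ys"]) (simp add: span_insert_span)
  qed
  then show ?thesis by blast
qed

end

section \<open>Growth\<close>

text \<open>
  Rescaling the argument by the constant \<open>d + 1\<close> does not change the growth exponent, because the ratio
  of \<open>ln ((d + 1) n)\<close> and \<open>ln n\<close> tends to 1.
\<close>

lemma limsup_log_growth_add:
  fixes D D' :: "nat \<Rightarrow> nat"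
  assumes pos: "\<And>n. 0 < D n" and le: "\<And>n. D n * (n + 1) ^ d \<le> D' ((d + 1) * n)"
  shows "limsup (\<lambda>n. ereal (log (real n) (real (D n)))) + ereal (real d)
    \<le> limsup (\<lambda>n. ereal (log (real n) (real (D' n))))"
proof -
  let ?k = "d + 1"
  let ?u = "\<lambda>n. ereal (log (real n) (real (D n)))" and ?v = "\<lambda>n. ereal (log (real n) (real (D' n)))"
  let ?r = "\<lambda>n. ln (real (?k * n)) / ln (real n)"
  have ln_top: "filterlim (\<lambda>n. ln (real n)) at_top sequentially"
    by (rule filterlim_compose[OF ln_at_top filterlim_real_sequentially])
  have "(\<lambda>n. ln (real ?k) / ln (real n) + 1) \<longlonglongrightarrow> 0 + 1"
    by (intro tendsto_add tendsto_const tendsto_divide_0[OF tendsto_const]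
        filterlim_at_top_imp_at_infinity ln_top)
  moreover have "\<forall>\<^sub>F n in sequentially. ln (real ?k) / ln (real n) + 1 = ?r n"
    using eventually_gt_at_top[of 1]
  proof eventually_elim
    case (elim n)
    then have "ln (real (?k * n)) = ln (real ?k) + ln (real n)"
      unfolding of_nat_mult by (intro ln_mult_pos) auto
    then show ?case using elim by (simp add: add_divide_distrib)
  qed
  ultimately have "?r \<longlonglongrightarrow> 1" by (simp add: tendsto_cong)
  then have lim: "(\<lambda>n. ereal (?r n)) \<longlonglongrightarrow> 1" by (simp add: one_ereal_def)
  have "limsup ?u + ereal (real d) = limsup (\<lambda>n. ?u n + ereal (real d))"
    by (rule Limsup_add_ereal_right[symmetric]) auto
  also have "\<dots> \<le> limsup (\<lambda>n. ereal (?r n) * ?v (?k * n))"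
  proof (rule Limsup_mono)
    show "\<forall>\<^sub>F n in sequentially. ?u n + ereal (real d) \<le> ereal (?r n) * ?v (?k * n)"
      using eventually_gt_at_top[of 1]
    proof eventually_elim
      case (elim n)
      then have "1 < real n" "1 < real (?k * n)" by (simp_all add: trans_less_add1 del: of_nat_mult)
      then have n: "0 < ln (real n)" "0 < ln (real (?k * n))" by (simp_all only: ln_gt_zero)
      have "real (D n) * real n ^ d \<le> real (D n) * real (n + 1) ^ d"
        by (intro mult_left_mono power_mono) auto
      also have "\<dots> = real (D n * (n + 1) ^ d)" by simp
      also have "\<dots> \<le> real (D' (?k * n))" by (rule of_nat_mono[OF le])
      finally have le': "real (D n) * real n ^ d \<le> real (D' (?k * n))" .
      have "ln (real (D n)) + real d * ln (real n) = ln (real (D n) * real n ^ d)"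
        using pos[of n] elim by (simp add: ln_mult_pos ln_realpow)
      also have "\<dots> \<le> ln (real (D' (?k * n)))"
        using le' pos[of n] elim by (intro ln_mono) auto
      finally have "(ln (real (D n)) + real d * ln (real n)) / ln (real n)
          \<le> ln (real (D' (?k * n))) / ln (real n)"
        using n by (intro divide_right_mono) auto
      then show ?case using n by (simp add: log_def add_divide_distrib)
    qed
  qed
  also have "\<dots> = 1 * limsup (\<lambda>n. ?v (?k * n))"
    by (rule ereal_limsup_lim_mult[OF lim]) auto
  also have "\<dots> \<le> limsup ?v"
  proof -
    have "strict_mono (\<lambda>n. ?k * n)" by (intro strict_monoI mult_strict_left_mono) simp_all
    from limsup_subseq_mono[OF this, of ?v] show ?thesis by (simp only: o_def mult_1)
  qed
  finally show ?thesis .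
qed

context assoc_algebra
begin

lemma card_le_dim_of_independent_family:
  assumes I: "finite I" "f ` I \<subseteq> A" and A: "A \<subseteq> span T" "finite T"
    and indep: "\<And>c i. (\<Sum>i\<in>I. scale (c i) (f i)) = 0 \<Longrightarrow> i \<in> I \<Longrightarrow> c i = 0"
  shows "card I \<le> dim A"
proof -
  have inj: "inj_on f I"
  proof (rule inj_onI, rule ccontr)
    fix i j assume ij: "i \<in> I" "j \<in> I" "f i = f j" "i \<noteq> j"
    \<comment> \<open>equal values at two indices give the relation with coefficients 1 and -1\<close>
    let ?c = "\<lambda>x. if x = i then 1 else if x = j then - 1 else 0 :: 'k"
    have "(\<Sum>x\<in>I. scale (?c x) (f x)) = (\<Sum>x\<in>{i, j}. scale (?c x) (f x))"
      using I(1) ij by (intro sum.mono_neutral_right) auto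
    also have "\<dots> = 0" using ij by simp
    finally show False using indep[of ?c i] ij by simp
  qed
  have ind: "independent (f ` I)"
  proof
    assume "dependent (f ` I)"
    then obtain u where u: "\<exists>v\<in>f ` I. u v \<noteq> 0" "(\<Sum>v\<in>f ` I. scale (u v) v) = 0"
      using dependent_finite[of "f ` I"] I(1) by auto
    then have "(\<Sum>i\<in>I. scale (u (f i)) (f i)) = 0" using inj by (simp add: sum.reindex)
    then show False using indep[of "\<lambda>i. u (f i)"] u(1) by auto
  qed
  obtain B where B: "f ` I \<subseteq> B" "B \<subseteq> A" "independent B" "A \<subseteq> span B"
    using maximal_independent_subset_extend[OF I(2) ind] by blast
  have "finite B" using independent_span_bound[OF A(2) B(3)] B(2) A(1) by auto
  then have "card (f ` I) \<le> card B" using B(1) by (intro card_mono)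
  also have "\<dots> = dim A" by (rule basis_card_eq_dim[OF B(2,4,3)])
  finally show ?thesis using inj by (simp add: card_image)
qed

lemma growth_space_span_subset:
  "growth_space (span B) n \<subseteq> span {prod_list xs | xs. set xs \<subseteq> B \<and> length xs \<le> n}"
proof -
  have "prod_list xs \<in> span {prod_list ys | ys. set ys \<subseteq> B \<and> length ys \<le> n}"
    if "set xs \<subseteq> span B" "length xs \<le> n" for xs n
    using that
  proof (induction xs arbitrary: n)
    case Nil
    show ?case by (intro span_base CollectI exI[of _ "[]"]) simp
  next
    case (Cons x xs)
    let ?P = "\<lambda>n. {prod_list ys | ys. set ys \<subseteq> B \<and> length ys \<le> n}"
    obtain m where m: "n = Suc m" using Cons.prems by (cases n) auto
    have xs: "prod_list xs \<in> span (?P m)" using Cons.prems m by (intro Cons.IH) simp_all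
    have "b * prod_list xs \<in> span (?P n)" if b: "b \<in> B" for b
    proof (rule mult_mem_of_span[OF subspace_span _ xs])
      fix z assume "z \<in> ?P m"
      then obtain ys where "z = prod_list ys" "set ys \<subseteq> B" "length ys \<le> m" by auto
      then show "b * z \<in> span (?P n)"
        using b m by (intro span_base CollectI exI[of _ "b # ys"]) simp
    qed
    then have "x * prod_list xs \<in> span (?P n)"
      using Cons.prems(1) by - (rule mult_mem_of_span_left[OF subspace_span, of B], simp_all)
    then show ?case by simp
  qed
  then show ?thesis
    unfolding growth_space_def[of "span B"]
    by (intro span_minimal[OF _ subspace_span] subsetI) (elim CollectE exE conjE, simp)
qed

lemma finite_products: "finite B \<Longrightarrow> finite {prod_list xs | xs :: 'h list. set xs \<subseteq> B \<and> length xs \<le> n}"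
proof -
  assume "finite B"
  then have "finite (prod_list ` {xs. set xs \<subseteq> B \<and> length xs \<le> n})"
    by (intro finite_imageI finite_lists_length_le)
  moreover have "{prod_list xs | xs :: 'h list. set xs \<subseteq> B \<and> length xs \<le> n} =
      prod_list ` {xs. set xs \<subseteq> B \<and> length xs \<le> n}" by auto
  ultimately show ?thesis by simp
qed

lemma dim_growth_space_pos:
  assumes "finite B"
  shows "0 < dim (growth_space (span B) n)"
proof -
  have one: "1 \<in> growth_space (span B) n"
    unfolding growth_space_def by (intro span_base CollectI exI[of _ "[]"]) simp
  have "card {()} \<le> dim (growth_space (span B) n)"
    by (rule card_le_dim_of_independent_family[OF _ _ growth_space_span_subset
          finite_products[OF assms], where f = "\<lambda>_. 1"])
      (use one in auto)
  then show ?thesis by simp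
qed

abbreviation growth_exponent :: "'h set \<Rightarrow> ereal" where
  "growth_exponent V \<equiv> limsup (\<lambda>n. ereal (log (real n) (real (dim (growth_space V n)))))"

lemma GKdim_upper: "finite B \<Longrightarrow> span B \<subseteq> A \<Longrightarrow> growth_exponent (span B) \<le> GKdim A"
  unfolding GKdim_def by (rule SUP_upper) auto

lemma GKdim_nonneg:
  assumes "subspace A"
  shows "0 \<le> GKdim A"
proof -
  have "0 \<le> growth_exponent (span {})"
  proof (rule order_trans[OF _ Limsup_mono[where f = "\<lambda>_. 0"]])
    show "\<forall>\<^sub>F n in sequentially. 0 \<le> ereal (log (real n) (real (dim (growth_space (span {}) n))))"
      using eventually_gt_at_top[of 1]
    proof eventually_elim
      case (elim n)
      then show ?case using dim_growth_space_pos[of "{}" n] by (simp add: Suc_le_eq zero_le_log_cancel_iff)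
    qed
  qed (simp add: Limsup_const)
  also have "\<dots> \<le> GKdim A" using assms by (intro GKdim_upper) (auto simp: subspace_0)
  finally show ?thesis .
qed

end

context hopf_algebra
begin

lemma prod_list_grouplike: "set hs \<subseteq> Collect grouplike \<Longrightarrow> grouplike (prod_list hs)"
  by (induction hs) (auto intro: grouplike_mult)

text \<open>
  The products of length at most \<open>n\<close> of the group-like elements that span \<open>V\<close>, times the monomials
  with all exponents at most \<open>n\<close>, are independent products of length at most \<open>(d + 1) n\<close>.
\<close>

lemma growth_exponent_add_le_GKdim:
  assumes adm: "admissible ys X" and V: "V \<subseteq> C0" "V = span B" "finite B"
  shows "growth_exponent V + ereal (real (length ys)) \<le> GKdim UNIV"
proof -
  let ?d = "length ys"
  have "\<forall>b\<in>B. \<exists>T. finite T \<and> T \<subseteq> Collect grouplike \<and> b \<in> span T"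
    using V span_superset[of B] span_finite_support unfolding C0_def by blast
  from bchoice[OF this] obtain T
    where T: "\<And>b. b \<in> B \<Longrightarrow> finite (T b) \<and> T b \<subseteq> Collect grouplike \<and> b \<in> span (T b)" by blast
  define S where "S = \<Union>(T ` B)"
  have S: "finite S" "S \<subseteq> Collect grouplike" using T V(3) by (auto simp: S_def)
  have "span (T b) \<subseteq> span S" if "b \<in> B" for b
    using that by (intro span_mono) (auto simp: S_def)
  then have BS: "V \<subseteq> span S" unfolding V(2) using T by (intro span_minimal subspace_span) auto
  \<comment> \<open>words in these letters contain the required products\<close>
  define W where "W = S \<union> set ys"
  have W: "finite W" using S by (simp add: W_def)
  let ?P = "\<lambda>n. {prod_list hs | hs. set hs \<subseteq> S \<and> length hs \<le> n}"
  let ?E = "\<lambda>n. {ns :: nat list. set ns \<subseteq> {..n} \<and> length ns = ?d}"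
  have "dim (growth_space V n) * (n + 1) ^ ?d \<le> dim (growth_space (span W) ((?d + 1) * n))" for n
  proof -
    have P: "finite (?P n)" by (rule finite_products[OF S(1)])
    have E: "finite (?E n)" "card (?E n) = (n + 1) ^ ?d"
      using finite_lists_length_eq[of "{..n}" ?d] card_lists_length_eq[of "{..n}" ?d] by auto
    have "growth_space V n \<subseteq> growth_space (span S) n"
      unfolding growth_space_def using BS by (intro span_mono) blast
    then have "dim (growth_space V n) \<le> card (?P n)"
      using growth_space_span_subset[of S n] by (intro dim_le_card P) auto
    then have "dim (growth_space V n) * (n + 1) ^ ?d \<le> card (?P n \<times> ?E n)"
      using E by (simp add: card_cartesian_product)
    also have "\<dots> \<le> dim (growth_space (span W) ((?d + 1) * n))"
    proof (rule card_le_dim_of_independent_family[OF _ _ growth_space_span_subset finite_products[OF W]])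
      show "finite (?P n \<times> ?E n)" using P E by simp
      show "(\<lambda>(h, ns). h * monomial ys ns) ` (?P n \<times> ?E n) \<subseteq> growth_space (span W) ((?d + 1) * n)"
      proof safe
        fix hs ns assume hs: "set hs \<subseteq> S" "length hs \<le> n" and ns: "set ns \<subseteq> {..n}" "length ns = ?d"
        obtain es where es: "set es \<subseteq> set ys" "length es = sum_list ns" "monomial ys ns = prod_list es"
          using monomial_word[OF ns(2)] by blast
        have "sum_list ns \<le> length ns * n" using ns(1) by (induction ns) auto
        then have "length (hs @ es) \<le> (?d + 1) * n" using hs es ns by simp
        moreover have "set (hs @ es) \<subseteq> span W"
          using hs es span_superset[of W] by (auto simp: W_def)
        moreover have "prod_list hs * monomial ys ns = prod_list (hs @ es)" by (simp add: es)
        ultimately show "prod_list hs * monomial ys ns \<in> growth_space (span W) ((?d + 1) * n)"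
          unfolding growth_space_def by (intro span_base) blast
      qed
      fix c p assume sum: "(\<Sum>i\<in>?P n \<times> ?E n. scale (c i) (case i of (h, ns) \<Rightarrow> h * monomial ys ns)) = 0"
        and p: "p \<in> ?P n \<times> ?E n"
      show "c p = 0"
      proof (rule coset_monomials_independent[OF adm _ _ _ p])
        show "finite (?P n \<times> ?E n)" using P E by simp
        show "grouplike h \<and> length ns = length ys" if "(h, ns) \<in> ?P n \<times> ?E n" for h ns
          using that S(2) prod_list_grouplike by auto
        show "(\<Sum>(h, ns)\<in>?P n \<times> ?E n. scale (c (h, ns)) (h * monomial ys ns)) = 0"
          using sum by (simp add: case_prod_unfold)
      qed
    qed
    finally show ?thesis .
  qed
  then have "growth_exponent V + ereal (real ?d) \<le> growth_exponent (span W)"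
    using dim_growth_space_pos[OF V(3)] unfolding V(2) by (intro limsup_log_growth_add)
  also have "\<dots> \<le> GKdim UNIV" by (rule GKdim_upper[OF W]) simp
  finally show ?thesis .
qed

lemma GKdim_C0_add_le:
  assumes "admissible ys X"
  shows "GKdim C0 + ereal (real (length ys)) \<le> GKdim UNIV"
proof -
  let ?I = "{V. subspace V \<and> V \<subseteq> C0 \<and> (\<exists>B. finite B \<and> V = span B)}"
  have "{0} \<in> ?I"
    using subspace_0[OF subspace_C0] by (auto intro: exI[of _ "{}"])
  then have ne: "?I \<noteq> {}" by blast
  have "GKdim C0 + ereal (real (length ys)) =
      (SUP V\<in>?I. growth_exponent V + ereal (real (length ys)))"
    unfolding GKdim_def by (rule SUP_ereal_add_left[OF ne, symmetric]) simp
  also have "\<dots> \<le> GKdim UNIV"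
    using growth_exponent_add_le_GKdim[OF assms] by (intro SUP_least) blast
  finally show ?thesis .
qed

end

context hopf_algebra_acf0
begin

theorem GKdim_lower_bound: "GKdim C0 + quotient_dim Z (span (C0 \<union> Y_sqrt)) \<le> GKdim UNIV"
proof -
  have le: "GKdim C0 + ereal (real d) \<le> GKdim UNIV"
    if "ereal (real d) \<le> quotient_dim Z (span (C0 \<union> Y_sqrt))" for d
    using exists_admissible[OF that] GKdim_C0_add_le by auto
  show ?thesis
  proof (cases "\<exists>d. quotient_dim Z (span (C0 \<union> Y_sqrt)) = ereal (real d)")
    case True
    then show ?thesis using le by auto
  next
    case False
    then have inf: "quotient_dim Z (span (C0 \<union> Y_sqrt)) = \<infinity>"
      by (auto simp: quotient_dim_def split: if_splits)
    have "ereal (real d) \<le> GKdim UNIV" for d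
      using add_mono[OF GKdim_nonneg[OF subspace_C0] order_refl, of "ereal (real d)"] le[of d] inf
      by auto
    then have "GKdim UNIV = \<infinity>"
      by (metis ereal_top linorder_not_le real_arch_simple ereal_less_eq(3) order_trans)
    then show ?thesis by simp
  qed
qed

end

theorem theorem0p4:
  fixes scale :: "'k::{alg_closed_field, field_char_0} \<Rightarrow> 'h::ring_1 \<Rightarrow> 'h"
    and comult :: "'h \<Rightarrow> ('h \<times> 'h \<Rightarrow>\<^sub>0 'k)"
    and counit :: "'h \<Rightarrow> 'k"
    and antipode :: "'h \<Rightarrow> 'h"
  assumes "hopf_algebra scale comult counit antipode"
    and "comm_group (hopf_algebra.W_times_subgroup scale comult)"
  shows "assoc_algebra.GKdim scale (UNIV :: 'h set) \<ge>
    assoc_algebra.GKdim scale (hopf_algebra.C0 scale comult) +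
    assoc_algebra.quotient_dim scale (hopf_algebra.Z scale comult)
      {a + b | a b. a \<in> hopf_algebra.C0 scale comult \<and> b \<in> hopf_algebra.Y_sqrt scale comult}"
proof -
  interpret hopf_algebra_acf0 scale comult counit antipode
    using assms(1) by (simp add: hopf_algebra_acf0_def)
  have closed: "span C0 = C0" "span Y_sqrt = Y_sqrt" by (simp_all add: Y_sqrt_def span_span)
  have "{a + b | a b. a \<in> C0 \<and> b \<in> Y_sqrt} = span (C0 \<union> Y_sqrt)"
    unfolding span_Un closed ..
  then show ?thesis using GKdim_lower_bound by simp
qed

end
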